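(* Let $T$ be a left-invariant $(0,2)$ tensor field on $SO(3)$. There exist a left-invariant Riemannian metric $g$ and a constant $c>0$ such that $\mathrm{Ric}(g)=cT$ if and only if $T$ is diagonalisable with $T=\mathrm{diag}(T_1,T_2,T_3)$ in a basis $V_1,V_2,V_3$ of the Lie algebra satisfying $[V_i,V_j]=\sum_{k=1}^3\epsilon_{ijk}\lambda_kV_k$ with $\lambda_1=\lambda_2=\lambda_3=2$, and one of the following conditions is satisfied: (i) $T_1\ge T_2\ge T_3>0$; (ii) $T_1>0$, $T_2=T_3=0$; (iii) $T_1>0$, $T_3\le T_2<0$, and either $\bar f\left(-\frac{T_1+T_2+T_3}{3}\right)\ge 0$ while $-\frac{T_1+T_2+T_3}{3}<0$, or else $\bar f(-T_1)>0$, where $\bar f(p)=2p^3+(T_1+T_2+T_3)p^2-T_1T_2T_3$. In case (i), the solution $(g,c)$ is unique. In case (ii), there are infinitely many solutions $(g,c)$, but $c$ is the same for all solutions. In case (iii), the solution $(g,c)$ is unique unless $\bar f(-T_1)<0$, $-\frac{T_1+T_2+T_3}{3}<0$ and $\bar f\left(-\frac{T_1+T_2+T_3}{3}\right)>0$, in which case there are (exactly) two solutions $(g_1,c_1)$ and $(g_2,c_2)$, with $c_1\ne c_2$.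
   Context: Left-invariant tensor fields are identified with tensors on the Lie algebra. $\mathrm{Ric}(g)$ is the Ricci curvature $(0,2)$-tensor of $g$, and $\epsilon_{ijk}$ is the Levi-Civita symbol. $T=\mathrm{diag}(T_1,T_2,T_3)$ in the basis $V_1,V_2,V_3$ means $T(V_i,V_i)=T_i$ and $T(V_i,V_j)=0$ for $i\neq j$. The basis is assumed ordered so that $T_1\ge T_2\ge T_3$; this can always be achieved because $\lambda_1=\lambda_2=\lambda_3$. If $(g,c)$ is a solution of $\mathrm{Ric}(g)=cT$, then so is $(c'g,c)$ for every $c'>0$; uniqueness and the number of solutions $(g,c)$ are always understood up to scaling of $g$ (so "unique" means that any other solution $(\bar g,\bar c)$ has $\bar c=c$ and $\bar g$ a positive multiple of $g$). *)

theory Defs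
  imports "HOL-Analysis.Analysis"
begin

lemma transpose_linear:
  fixes A B :: "real^'n^'m"
  shows "transpose (0 :: real^'n^'m) = 0"
    and "transpose (A + B) = transpose A + transpose B"
    and "transpose (A - B) = transpose A - transpose B"
    and "transpose (- A) = - transpose A"
    and "transpose (r *\<^sub>R A) = r *\<^sub>R transpose A"
  by (simp_all add: transpose_def vec_eq_iff)

text \<open>The Lie algebra of SO(3), with \<open>lie\<close> below as its bracket.\<close>

typedef so3 = "{A :: real^3^3. transpose A = - A}"
  morphisms mat_of_so3 so3_of_mat
  by (rule exI[of _ 0]) (simp add: transpose_linear)

setup_lifting type_definition_so3

instantiation so3 :: real_vector
begin

lift_definition zero_so3 :: so3 is 0
  by (simp add: transpose_linear)

lift_definition plus_so3 :: "so3 \<Rightarrow> so3 \<Rightarrow> so3" is "(+)"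
  by (simp add: transpose_linear)

lift_definition minus_so3 :: "so3 \<Rightarrow> so3 \<Rightarrow> so3" is "(-)"
  by (simp add: transpose_linear)

lift_definition uminus_so3 :: "so3 \<Rightarrow> so3" is uminus
  by (simp add: transpose_linear)

lift_definition scaleR_so3 :: "real \<Rightarrow> so3 \<Rightarrow> so3" is scaleR
  by (simp add: transpose_linear)

instance
  by standard (transfer; simp add: algebra_simps)+

end

lift_definition lie :: "so3 \<Rightarrow> so3 \<Rightarrow> so3" is "\<lambda>A B. A ** B - B ** A"
proof -
  fix A B :: "real^3^3"
  assume a: "transpose A = - A" "transpose B = - B"
  have "(- X) ** (- Y) = X ** Y" for X Y :: "real^3^3"
    by (simp add: matrix_matrix_mult_def)
  then show "transpose (A ** B - B ** A) = - (A ** B - B ** A)"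
    by (simp add: transpose_linear matrix_transpose_mul a)
qed

text \<open>A left-invariant tensor field of type (0,2) is a bilinear form on the Lie algebra.\<close>

definition left_inv_metric :: "(so3 \<Rightarrow> so3 \<Rightarrow> real) \<Rightarrow> bool" where
  "left_inv_metric g \<longleftrightarrow>
     bilinear g \<and> (\<forall>X Y. g X Y = g Y X) \<and> (\<forall>X. X \<noteq> 0 \<longrightarrow> g X X > 0)"

text \<open>The Levi-Civita connection on left-invariant vector fields. Since \<open>g Y Z\<close> is a
  constant function for left-invariant \<open>Y\<close> and \<open>Z\<close>, its derivative along \<open>X\<close>
  vanishes, so metric compatibility reads \<open>0 = g (D X Y) Z + g Y (D X Z)\<close>.\<close>

definition is_levi_civita ::
  "(so3 \<Rightarrow> so3 \<Rightarrow> real) \<Rightarrow> (so3 \<Rightarrow> so3 \<Rightarrow> so3) \<Rightarrow> bool" where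
  "is_levi_civita g D \<longleftrightarrow>
     bilinear D \<and>
     (\<forall>X Y. D X Y - D Y X = lie X Y) \<and>
     (\<forall>X Y Z. g (D X Y) Z + g Y (D X Z) = 0)"

definition levi_civita :: "(so3 \<Rightarrow> so3 \<Rightarrow> real) \<Rightarrow> so3 \<Rightarrow> so3 \<Rightarrow> so3" where
  "levi_civita g = (THE D. is_levi_civita g D)"

definition riemann :: "(so3 \<Rightarrow> so3 \<Rightarrow> real) \<Rightarrow> so3 \<Rightarrow> so3 \<Rightarrow> so3 \<Rightarrow> so3" where
  "riemann g X Y Z =
     (let D = levi_civita g in D X (D Y Z) - D Y (D X Z) - D (lie X Y) Z)"

text \<open>The trace of an endomorphism of a finite-dimensional space; it does not depend on
  the basis chosen.\<close>

definition endo_trace :: "('a::real_vector \<Rightarrow> 'a) \<Rightarrow> real" where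
  "endo_trace f =
     (let B = (SOME B. independent B \<and> span B = UNIV)
      in \<Sum>b\<in>B. representation B (f b) b)"

definition ricci :: "(so3 \<Rightarrow> so3 \<Rightarrow> real) \<Rightarrow> so3 \<Rightarrow> so3 \<Rightarrow> real" where
  "ricci g Y Z = endo_trace (\<lambda>X. riemann g X Y Z)"

definition solution :: "(so3 \<Rightarrow> so3 \<Rightarrow> real) \<Rightarrow> (so3 \<Rightarrow> so3 \<Rightarrow> real) \<Rightarrow> real \<Rightarrow> bool" where
  "solution T g c \<longleftrightarrow>
     left_inv_metric g \<and> c > 0 \<and> (\<forall>X Y. ricci g X Y = c * T X Y)"

definition same_up_to_scaling ::
  "(so3 \<Rightarrow> so3 \<Rightarrow> real) \<times> real \<Rightarrow> (so3 \<Rightarrow> so3 \<Rightarrow> real) \<times> real \<Rightarrow> bool" where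
  "same_up_to_scaling s s' \<longleftrightarrow>
     snd s' = snd s \<and> (\<exists>a>0. \<forall>X Y. fst s' X Y = a * fst s X Y)"

definition unique_solution :: "(so3 \<Rightarrow> so3 \<Rightarrow> real) \<Rightarrow> bool" where
  "unique_solution T \<longleftrightarrow>
     (\<exists>g c. solution T g c \<and>
        (\<forall>g' c'. solution T g' c' \<longrightarrow> same_up_to_scaling (g, c) (g', c')))"

definition solution_classes ::
  "(so3 \<Rightarrow> so3 \<Rightarrow> real) \<Rightarrow> ((so3 \<Rightarrow> so3 \<Rightarrow> real) \<times> real) set set" where
  "solution_classes T =
     {(g, c). solution T g c} //
     {(s, s'). (\<forall>u\<in>{s, s'}. solution T (fst u) (snd u)) \<and> same_up_to_scaling s s'}"

definition levi_civita_symbol :: "3 \<Rightarrow> 3 \<Rightarrow> 3 \<Rightarrow> real" where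
  "levi_civita_symbol i j k =
     (if (i, j, k) \<in> {(1, 2, 3), (2, 3, 1), (3, 1, 2)} then 1
      else if (i, j, k) \<in> {(3, 2, 1), (1, 3, 2), (2, 1, 3)} then -1
      else 0)"

definition milnor_basis :: "(3 \<Rightarrow> real) \<Rightarrow> (3 \<Rightarrow> so3) \<Rightarrow> bool" where
  "milnor_basis l V \<longleftrightarrow>
     inj V \<and> independent (range V) \<and> span (range V) = UNIV \<and>
     (\<forall>i j. lie (V i) (V j) = (\<Sum>k\<in>UNIV. (levi_civita_symbol i j k * l k) *\<^sub>R V k))"

definition diagonal_in ::
  "(3 \<Rightarrow> so3) \<Rightarrow> (so3 \<Rightarrow> so3 \<Rightarrow> real) \<Rightarrow> (3 \<Rightarrow> real) \<Rightarrow> bool" where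
  "diagonal_in V T t \<longleftrightarrow> (\<forall>i j. T (V i) (V j) = (if i = j then t i else 0))"

definition ordered_diagonalisation ::
  "(so3 \<Rightarrow> so3 \<Rightarrow> real) \<Rightarrow> (3 \<Rightarrow> so3) \<Rightarrow> (3 \<Rightarrow> real) \<Rightarrow> bool" where
  "ordered_diagonalisation T V t \<longleftrightarrow>
     milnor_basis (\<lambda>_. 2) V \<and> diagonal_in V T t \<and> t 1 \<ge> t 2 \<and> t 2 \<ge> t 3"

definition fbar :: "(3 \<Rightarrow> real) \<Rightarrow> real \<Rightarrow> real" where
  "fbar t p = 2 * p^3 + (t 1 + t 2 + t 3) * p^2 - t 1 * t 2 * t 3"

definition cond_i :: "(3 \<Rightarrow> real) \<Rightarrow> bool" where
  "cond_i t \<longleftrightarrow> t 1 \<ge> t 2 \<and> t 2 \<ge> t 3 \<and> t 3 > 0"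

definition cond_ii :: "(3 \<Rightarrow> real) \<Rightarrow> bool" where
  "cond_ii t \<longleftrightarrow> t 1 > 0 \<and> t 2 = 0 \<and> t 3 = 0"

definition cond_iii :: "(3 \<Rightarrow> real) \<Rightarrow> bool" where
  "cond_iii t \<longleftrightarrow>
     t 1 > 0 \<and> t 3 \<le> t 2 \<and> t 2 < 0 \<and>
     ((fbar t (- ((t 1 + t 2 + t 3) / 3)) \<ge> 0 \<and> - ((t 1 + t 2 + t 3) / 3) < 0) \<or>
      fbar t (- t 1) > 0)"

definition cond_two_solutions :: "(3 \<Rightarrow> real) \<Rightarrow> bool" where
  "cond_two_solutions t \<longleftrightarrow>
     fbar t (- t 1) < 0 \<and> - ((t 1 + t 2 + t 3) / 3) < 0 \<and>
     fbar t (- ((t 1 + t 2 + t 3) / 3)) > 0"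

end

theory Submission
  imports Defs
begin

text \<open>All bases \<open>V\<close> of the Lie algebra with structure constants 2 come from linear isomorphisms
\<open>h\<close> from \<open>\<real>\<^sup>3\<close>, called frames here, that turn the bracket into twice the cross product.
The Killing form equals \<open>- 8 (u \<bullet> v)\<close> in every frame, so two frames differ by an isometry, and
by the spectral theorem every symmetric form is diagonal in some frame.

If a metric is diagonal with entries \<open>x\<^sub>i\<close>, put \<open>s = x\<^sub>1 + x\<^sub>2 + x\<^sub>3\<close> and \<open>e\<^sub>i = s - 2 x\<^sub>i\<close>. An explicit
Levi-Civita connection shows that the Ricci tensor is diagonal in the same frame, with first entry
\<open>2 e\<^sub>2 e\<^sub>3 / (x\<^sub>2 x\<^sub>3)\<close> and cyclically. Hence a solution and \<open>T\<close> are diagonal in a common frame, which can be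
ordered, and the equation becomes \<open>2 e\<^sub>2 e\<^sub>3 = c T\<^sub>1 x\<^sub>2 x\<^sub>3\<close> and cyclically. At most one \<open>e\<^sub>i\<close> is nonpositive;
if it is zero, then two of the \<open>T\<^sub>i\<close> vanish, the third is \<open>8 / c\<close>, and only \<open>x\<^sub>1 = x\<^sub>2 + x\<^sub>3\<close> remains to be
satisfied. This is case (ii).

If no \<open>T\<^sub>i\<close> vanishes, the number \<open>p = T\<^sub>i e\<^sub>i / (2 x\<^sub>i)\<close> does not depend on \<open>i\<close>, and
\<open>x\<^sub>i = (s / 2) T\<^sub>i / (p + T\<^sub>i)\<close>. Summation over \<open>i\<close> gives \<open>\<Sum> T\<^sub>i / (p + T\<^sub>i) = 2\<close>, which is the cubic
equation \<open>fbar p = 0\<close>, and \<open>c = 8 p\<^sup>2 / (T\<^sub>1 T\<^sub>2 T\<^sub>3)\<close>,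
which forces \<open>T\<^sub>1 T\<^sub>2 T\<^sub>3 > 0\<close>. Under this condition, solutions up to scaling correspond to the nonzero
roots \<open>p\<close> of \<open>fbar\<close> for which all \<open>T\<^sub>i / (p + T\<^sub>i)\<close> are positive
(\<open>ricci_eigenvalue_imp_root\<close>, \<open>root_imp_ricci_eigenvalue\<close>, \<open>solution_iff_root\<close>).
For positive \<open>T\<^sub>i\<close> these are the positive roots, and there is exactly one. For signs \<open>+, -, -\<close> they are the
roots in \<open>(- T\<^sub>1, 0)\<close>. There \<open>fbar\<close> is negative at 0 and has its only local maximum over the negative
numbers at \<open>- (T\<^sub>1 + T\<^sub>2 + T\<^sub>3) / 3\<close>, if that is negative; counting roots by the sign of \<open>fbar\<close> at this
point and at \<open>- T\<^sub>1\<close> gives case (iii).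

If no \<open>T\<^sub>i\<close> vanishes, a solution is diagonal in every eigenframe of \<open>T\<close>, even if \<open>T\<close> has a double eigenvalue,
because by the formula for \<open>x\<^sub>i\<close> equal \<open>T\<^sub>i\<close> have equal \<open>x\<^sub>i\<close>
(\<open>diagonal_form_transfer\<close>).\<close>

section \<open>Frames of the Lie algebra\<close>

text \<open>A basis with structure constants 2, encoded by its coordinate isomorphism, so that the algebra of
\<open>\<real>\<^sup>3\<close> and its cross product become available.\<close>

definition so3_frame :: "(real^3 \<Rightarrow> so3) \<Rightarrow> bool" where
  "so3_frame h \<longleftrightarrow> linear h \<and> bij h \<and> (\<forall>u v. lie (h u) (h v) = 2 *\<^sub>R h (cross3 u v))"

lemma so3_frameD:
  assumes "so3_frame h"
  shows "linear h" "bij h" "lie (h u) (h v) = 2 *\<^sub>R h (cross3 u v)"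
    "inv h (h u) = u" "h (inv h X) = X" "linear (inv h)" "h u = h v \<longleftrightarrow> u = v"
proof -
  show h: "linear h" and b: "bij h" and "lie (h u) (h v) = 2 *\<^sub>R h (cross3 u v)"
    using assms by (simp_all add: so3_frame_def)
  show "inv h (h u) = u" "h (inv h X) = X" "h u = h v \<longleftrightarrow> u = v"
    using b by (simp_all add: bij_is_inj bij_is_surj surj_f_inv_f inj_eq)
  show "linear (inv h)"
  proof (rule linearI)
    fix r X Y
    have "h (inv h X + inv h Y) = X + Y" "h (r *\<^sub>R inv h X) = r *\<^sub>R X"
      using b by (simp_all add: linear_add[OF h] linear_scale[OF h] bij_is_surj surj_f_inv_f)
    then show "inv h (X + Y) = inv h X + inv h Y" "inv h (r *\<^sub>R X) = r *\<^sub>R inv h X"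
      using b by (metis bij_is_inj inv_f_f)+
  qed
qed

lemma linear_eq_sum_axis:
  assumes "linear h"
  shows "h v = (\<Sum>i\<in>UNIV. v $ i *\<^sub>R h (axis i 1))"
proof -
  have "v = (\<Sum>i\<in>UNIV. v $ i *\<^sub>R axis i 1)"
    by (simp add: vec_eq_iff axis_def if_distrib cong: if_cong)
  then have "h v = h (\<Sum>i\<in>UNIV. v $ i *\<^sub>R axis i 1)" by simp
  then show ?thesis
    by (simp add: linear_sum[OF assms] linear_scale[OF assms])
qed

lemma bilinear_lie: "bilinear lie"
proof -
  have m: "(X + Y) ** Z = X ** Z + Y ** Z" "Z ** (X + Y) = Z ** X + Z ** Y"
    "(r *\<^sub>R X) ** Z = r *\<^sub>R (X ** Z)" "Z ** (r *\<^sub>R X) = r *\<^sub>R (Z ** X)"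
    for X Y Z :: "real^3^3" and r
    by (simp_all add: matrix_matrix_mult_def vec_eq_iff sum.distrib sum_distrib_left algebra_simps)
  have "lie (X + Y) Z = lie X Z + lie Y Z" "lie Z (X + Y) = lie Z X + lie Z Y"
    "lie (r *\<^sub>R X) Z = r *\<^sub>R lie X Z" "lie Z (r *\<^sub>R X) = r *\<^sub>R lie Z X" for X Y Z r
    by (transfer; simp add: m algebra_simps)+
  then show ?thesis
    by (simp add: bilinear_def linear_iff)
qed

text \<open>Together with the converse below, this identifies frames with the bases
of the theorem.\<close>

lemma so3_frame_axis:
  assumes "so3_frame h"
  shows "milnor_basis (\<lambda>_. 2) (\<lambda>i. h (axis i 1))"
proof -
  note h = so3_frameD[OF assms]
  have inj: "inj (\<lambda>i::3. h (axis i 1))"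
    by (auto simp: inj_def h axis_eq_axis)
  have rng: "range (\<lambda>i::3. h (axis i 1)) = h ` Basis"
    by (auto simp: Basis_vec_def)
  have "independent (range (\<lambda>i::3. h (axis i 1)))"
    unfolding rng using independent_Basis h(1) bij_is_inj[OF h(2)]
    by (meson inj_on_subset linear_independent_injective_image subset_UNIV)
  moreover have "span (range (\<lambda>i::3. h (axis i 1))) = UNIV"
    unfolding rng using h(1,2) by (simp add: linear_span_image span_Basis bij_is_surj)
  moreover have "lie (h (axis i 1)) (h (axis j 1))
      = (\<Sum>k\<in>UNIV. (levi_civita_symbol i j k * 2) *\<^sub>R h (axis k 1))" for i j :: 3
    using exhaust_3[of i] exhaust_3[of j]
    by (auto simp: h(3) levi_civita_symbol_def sum_3 cross_basis linear_neg[OF h(1)] linear_0[OF h(1)])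
  ultimately show ?thesis
    using inj by (simp add: milnor_basis_def)
qed

lemma milnor_basis_frame:
  assumes "milnor_basis (\<lambda>_. 2) V"
  obtains h where "so3_frame h" "\<And>i. V i = h (axis i 1)"
proof -
  define h where "h u = (\<Sum>i\<in>UNIV. u $ i *\<^sub>R V i)" for u :: "real^3"
  note V = assms[unfolded milnor_basis_def]
  have lin: "linear h"
    unfolding h_def by (rule linearI) (simp_all add: sum.distrib scaleR_left_distrib scaleR_sum_right)
  have ax: "V i = h (axis i 1)" for i
    by (simp add: h_def axis_def if_distrib [where f = "\<lambda>a. a *\<^sub>R _"] cong: if_cong)
  have rng: "range V = h ` Basis"
    by (auto simp: Basis_vec_def ax)
  have "inj_on h Basis"
    using V by (auto simp: inj_on_def Basis_vec_def ax inj_def)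
  then have "inj h"
    using V lin linear_inj_on_span_independent_image[of h Basis] by (simp add: rng)
  moreover have "surj h"
    using V lin by (simp add: rng linear_span_image)
  moreover have "lie (h u) (h v) = 2 *\<^sub>R h (cross3 u v)" for u v
  proof -
    have lV: "lie (V i) (V j) = (\<Sum>k\<in>UNIV. (levi_civita_symbol i j k * 2) *\<^sub>R V k)" for i j
      using V by blast
    have "lie (h u) (h v) = (\<Sum>i\<in>UNIV. \<Sum>j\<in>UNIV. (u $ i * v $ j) *\<^sub>R lie (V i) (V j))"
      unfolding h_def bilinear_sum[OF bilinear_lie] sum.cartesian_product
      by (simp add: bilinear_lmul[OF bilinear_lie] bilinear_rmul[OF bilinear_lie] mult.commute)
    also have "\<dots> = 2 *\<^sub>R h (cross3 u v)"
      by (simp add: lV sum_3 levi_civita_symbol_def h_def cross_components algebra_simps)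
    finally show ?thesis .
  qed
  ultimately have "so3_frame h"
    using lin by (simp add: so3_frame_def bij_def)
  then show thesis using that ax by blast
qed

text \<open>The factor 2 on the usual matrix of \<open>cross3 v\<close> produces the
structure constants 2.\<close>

lift_definition so3_of_vec :: "real^3 \<Rightarrow> so3" is
  "\<lambda>v. vector [vector [0, - 2 * v$3, 2 * v$2], vector [2 * v$3, 0, - 2 * v$1],
             vector [- 2 * v$2, 2 * v$1, 0]]"
  by (simp add: transpose_def vec_eq_iff forall_3)

lemma so3_frame_exists: "so3_frame so3_of_vec"
proof -
  have "linear so3_of_vec"
    by (rule linearI; transfer; simp add: vec_eq_iff forall_3 algebra_simps)
  moreover have "lie (so3_of_vec u) (so3_of_vec v) = 2 *\<^sub>R so3_of_vec (cross3 u v)" for u v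
    by (transfer; simp add: vec_eq_iff forall_3 cross_components matrix_matrix_mult_def sum_3 algebra_simps)
  moreover have "so3_of_vec u = so3_of_vec v \<Longrightarrow> u = v" for u v
    by (transfer; simp add: vec_eq_iff forall_3)
  moreover have "\<exists>v. X = so3_of_vec v" for X
  proof (transfer, goal_cases)
    case (1 X)
    have "X $ i $ j = - X $ j $ i" for i j
    proof -
      have "X $ i $ j = transpose X $ j $ i" by (simp add: transpose_def)
      then show ?thesis by (simp only: 1 vector_uminus_component)
    qed
    from this[of 1 1] this[of 2 2] this[of 3 3] this[of 1 2] this[of 1 3] this[of 2 3]
    show ?case
      by (intro exI[of _ "vector [X$3$2 / 2, X$1$3 / 2, X$2$1 / 2]"])
        (simp add: vec_eq_iff forall_3)
  qed
  ultimately show ?thesis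
    by (simp add: so3_frame_def bij_def inj_def surj_def)
qed

section \<open>Traces and the Killing form\<close>

text \<open>The base change argument: expanding the elements of one basis in the other turns either
diagonal sum into the same double sum.\<close>

lemma endo_trace_basis:
  fixes f :: "'a::real_vector \<Rightarrow> 'a"
  assumes f: "linear f" and B: "independent B" "span B = UNIV" "finite B"
  shows "endo_trace f = (\<Sum>b\<in>B. representation B (f b) b)"
proof -
  have "(\<Sum>c\<in>C. representation C (f c) c) = (\<Sum>b\<in>B. representation B (f b) b)"
    if C: "independent C" "span C = UNIV" for C
  proof -
    have "finite C"
      using independent_span_bound[of B C] B C by auto
    note fin = this B(3)
    have "representation C (f c) c = (\<Sum>b\<in>B. representation B c b * representation C (f b) c)" for c
    proof -
      have "f c = f (\<Sum>b\<in>B. representation B c b *\<^sub>R b)"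
        using B by (simp add: real_vector.sum_representation_eq)
      then show ?thesis
        using C by (simp add: linear_sum[OF f] linear_scale[OF f]
            real_vector.representation_sum real_vector.representation_scale)
    qed
    then have "(\<Sum>c\<in>C. representation C (f c) c) =
        (\<Sum>c\<in>C. \<Sum>b\<in>B. representation B c b * representation C (f b) c)"
      by simp
    also have "\<dots> = (\<Sum>b\<in>B. \<Sum>c\<in>C. representation C (f b) c * representation B c b)"
      by (subst sum.swap) (simp add: mult.commute)
    also have "\<dots> = (\<Sum>b\<in>B. representation B (\<Sum>c\<in>C. representation C (f b) c *\<^sub>R c) b)"
      using B by (simp add: real_vector.representation_sum real_vector.representation_scale)
    also have "\<dots> = (\<Sum>b\<in>B. representation B (f b) b)"
      using C fin by (simp add: real_vector.sum_representation_eq)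
    finally show ?thesis .
  qed
  moreover have "\<exists>C::'a set. independent C \<and> span C = UNIV" using B by blast
  then have "independent (SOME C::'a set. independent C \<and> span C = UNIV)"
      "span (SOME C::'a set. independent C \<and> span C = UNIV) = UNIV"
    by (metis (mono_tags, lifting) someI_ex)+
  ultimately show ?thesis
    unfolding endo_trace_def Let_def by blast
qed

lemma endo_trace_frame:
  assumes h: "so3_frame h" and f: "linear f"
  shows "endo_trace f = (\<Sum>i\<in>UNIV. inv h (f (h (axis i 1))) $ i)"
proof -
  define V where "V i = h (axis i 1)" for i :: 3
  note hh = so3_frameD[OF h]
  have V: "inj V" "independent (range V)" "span (range V) = UNIV"
    using so3_frame_axis[OF h] by (simp_all add: milnor_basis_def V_def[abs_def])
  have "representation (range V) X (V i) = inv h X $ i" for X i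
  proof -
    have "X = (\<Sum>j\<in>UNIV. inv h X $ j *\<^sub>R V j)"
      using linear_eq_sum_axis[OF hh(1), of "inv h X"] by (simp add: hh V_def)
    then have "representation (range V) X (V i) =
        representation (range V) (\<Sum>j\<in>UNIV. inv h X $ j *\<^sub>R V j) (V i)" by simp
    also have "\<dots> = (\<Sum>j\<in>UNIV. inv h X $ j * (if V i = V j then 1 else 0))"
      using V by (simp add: real_vector.representation_sum real_vector.representation_scale
        real_vector.representation_basis)
    also have "\<dots> = inv h X $ i"
      using V(1) by (simp add: inj_eq if_distrib cong: if_cong)
    finally show ?thesis .
  qed
  then show ?thesis
    using V by (simp add: endo_trace_basis[OF f V(2,3)] sum.reindex) (simp add: V_def)
qed

text \<open>The left-hand side is the Killing form. It makes no reference to \<open>h\<close>, which makes the inner product of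
coordinates independent of the frame.\<close>

lemma killing_form_frame:
  assumes h: "so3_frame h"
  shows "endo_trace (\<lambda>Z. lie (h u) (lie (h v) Z)) = - 8 * (u \<bullet> v)"
proof -
  have "linear (\<lambda>Z. lie (h u) (lie (h v) Z))"
    using bilinear_lie by (simp add: bilinear_def linear_iff)
  then have "endo_trace (\<lambda>Z. lie (h u) (lie (h v) Z)) =
      (\<Sum>i\<in>UNIV. 4 * (cross3 u (cross3 v (axis i 1)) $ i))"
    using so3_frameD[OF h]
    by (simp add: endo_trace_frame[OF h] bilinear_rmul[OF bilinear_lie] linear_scale)
  also have "\<dots> = - 8 * (u \<bullet> v)"
    by (simp add: sum_3 cross_components axis_def inner_vec_def algebra_simps)
  finally show ?thesis .
qed

lemma so3_frame_isometry:
  assumes h: "so3_frame h" and k: "so3_frame k"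
  shows "inv k (h u) \<bullet> inv k (h v) = u \<bullet> v"
  using killing_form_frame[OF h, of u v] killing_form_frame[OF k, of "inv k (h u)" "inv k (h v)"]
  by (simp add: so3_frameD[OF k])

section \<open>Diagonal forms\<close>

text \<open>This is bilinearity and diagonality in
the basis of \<open>h\<close> at once.\<close>

definition diagonal_form :: "(real^3 \<Rightarrow> so3) \<Rightarrow> (3 \<Rightarrow> real) \<Rightarrow> (so3 \<Rightarrow> so3 \<Rightarrow> real) \<Rightarrow> bool" where
  "diagonal_form h x B \<longleftrightarrow> (\<forall>u v. B (h u) (h v) = (\<Sum>i\<in>UNIV. x i * u $ i * v $ i))"

lemma diagonal_form_exists:
  assumes "so3_frame h"
  shows "diagonal_form h x (\<lambda>X Y. \<Sum>i\<in>UNIV. x i * inv h X $ i * inv h Y $ i)"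
  by (simp add: diagonal_form_def so3_frameD[OF assms])

lemma diagonal_form_eq:
  assumes h: "so3_frame h" and B: "diagonal_form h x B"
  shows "B X Y = (\<Sum>i\<in>UNIV. x i * inv h X $ i * inv h Y $ i)"
  using B so3_frameD(5)[OF h] unfolding diagonal_form_def by metis

lemma diagonal_form_axis:
  assumes "diagonal_form h x B"
  shows "B (h (axis i 1)) (h (axis j 1)) = (if i = j then x i else 0)"
  using assms exhaust_3[of i] exhaust_3[of j] by (auto simp: diagonal_form_def sum_3 axis_def)

lemma diagonal_form_unique:
  assumes "diagonal_form h x B" "diagonal_form h y B"
  shows "x = y"
proof
  show "x i = y i" for i
    using diagonal_form_axis[OF assms(1), of i i] diagonal_form_axis[OF assms(2), of i i] by simp
qed

lemma diagonal_in_frame_iff: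
  assumes h: "so3_frame h" and B: "bilinear B"
  shows "diagonal_in (\<lambda>i. h (axis i 1)) B t \<longleftrightarrow> diagonal_form h t B"
proof
  assume d: "diagonal_in (\<lambda>i. h (axis i 1)) B t"
  note hh = so3_frameD[OF h]
  have "B (h u) (h v) = (\<Sum>i\<in>UNIV. t i * u $ i * v $ i)" for u v
  proof -
    have "B (h u) (h v) = (\<Sum>i\<in>UNIV. \<Sum>j\<in>UNIV. (u $ i * v $ j) * B (h (axis i 1)) (h (axis j 1)))"
      by (subst linear_eq_sum_axis[OF hh(1), of u], subst linear_eq_sum_axis[OF hh(1), of v])
        (simp add: bilinear_sum[OF B] sum.cartesian_product bilinear_lmul[OF B]
          bilinear_rmul[OF B] mult.assoc mult.left_commute)
    also have "\<dots> = (\<Sum>i\<in>UNIV. t i * u $ i * v $ i)"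
      using d by (simp add: diagonal_in_def sum_3)
    finally show ?thesis .
  qed
  then show "diagonal_form h t B" by (simp add: diagonal_form_def)
qed (simp add: diagonal_in_def diagonal_form_axis)

lemma diagonal_form_bilinear:
  assumes "so3_frame h" "diagonal_form h x B"
  shows "bilinear B" "B X Y = B Y X"
proof -
  note h = so3_frameD[OF assms(1)]
  have B: "B X Y = (\<Sum>i\<in>UNIV. x i * inv h X $ i * inv h Y $ i)" for X Y
    using assms(2) unfolding diagonal_form_def by (metis h(5))
  show "bilinear B"
    using h(6) by (simp add: bilinear_def linear_iff B sum.distrib sum_distrib_left algebra_simps)
  show "B X Y = B Y X" by (simp add: B mult.commute mult.left_commute)
qed

lemma diagonal_form_metric:
  assumes "so3_frame h" "diagonal_form h x g"
  shows "left_inv_metric g \<longleftrightarrow> (\<forall>i. x i > 0)"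
proof
  note h = so3_frameD[OF assms(1)]
  assume g: "left_inv_metric g"
  show "\<forall>i. x i > 0"
  proof
    fix i
    have "h (axis i 1) \<noteq> 0"
      using h(7)[of "axis i 1" 0] by (simp add: linear_0[OF h(1)] axis_eq_0_iff)
    then have "g (h (axis i 1)) (h (axis i 1)) > 0" using g by (simp add: left_inv_metric_def)
    then show "x i > 0"
      using assms(2) by (simp add: diagonal_form_def axis_def if_distrib cong: if_cong)
  qed
next
  note h = so3_frameD[OF assms(1)]
  assume x: "\<forall>i. x i > 0"
  have "g X X > 0" if "X \<noteq> 0" for X
  proof -
    have "inv h X \<noteq> 0" using that h(5)[of X] linear_0[OF h(1)] by metis
    then obtain i where "inv h X $ i \<noteq> 0" by (auto simp: vec_eq_iff)
    then have "0 < (\<Sum>i\<in>UNIV. x i * inv h X $ i * inv h X $ i)"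
      using x by (intro sum_pos2[of _ i]) (auto simp: mult.assoc less_imp_le zero_less_mult_iff zero_le_mult_iff linorder_neq_iff)
    then show ?thesis using assms(2) unfolding diagonal_form_def by (metis h(5))
  qed
  then show "left_inv_metric g"
    using diagonal_form_bilinear[OF assms] by (simp add: left_inv_metric_def)
qed

section \<open>The Levi-Civita connection and the Ricci tensor of a diagonal metric\<close>

text \<open>The difference \<open>S\<close> of two such connections makes \<open>g (S X Y) Z\<close> symmetric in \<open>X, Y\<close> and antisymmetric
in \<open>Y, Z\<close>. Passing through all permutations gives \<open>g (S X Y) Z = - g (S X Y) Z\<close>.\<close>

lemma levi_civita_unique:
  assumes g: "left_inv_metric g" and D: "is_levi_civita g D" and D': "is_levi_civita g D'"
  shows "D = D'"
proof (intro ext)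
  fix X Y
  have bg: "bilinear g" and sym: "\<And>X Y. g X Y = g Y X"
    using g by (simp_all add: left_inv_metric_def)
  define S where "S X Y = D X Y - D' X Y" for X Y
  have S: "S X Y = S Y X" for X Y
  proof -
    have "D X Y - D Y X = D' X Y - D' Y X"
      using D D' by (simp add: is_levi_civita_def)
    then show ?thesis by (simp add: S_def algebra_simps)
  qed
  have A: "g (S X Y) Z = - g (S X Z) Y" for X Y Z
  proof -
    have "g (D X Y) Z + g Y (D X Z) = 0" "g (D' X Y) Z + g Y (D' X Z) = 0"
      using D D' by (simp_all add: is_levi_civita_def)
    then show ?thesis
      by (simp add: S_def bilinear_lsub[OF bg] sym[of Y])
  qed
  have "g (S X Y) Z = 0" for Z
    using A[of X Y Z] A[of Z X Y] A[of Y Z X] by (simp add: S[of Y X] S[of Z X] S[of Z Y])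
  then have "S X Y = 0" using g by (metis left_inv_metric_def less_irrefl)
  then show "D X Y = D' X Y" by (simp add: S_def)
qed

text \<open>Coordinates of the Levi-Civita connection of the metric with diagonal entries \<open>x\<close>, as found from the
Koszul formula: with \<open>e\<^sub>i = x\<^sub>1 + x\<^sub>2 + x\<^sub>3 - 2 x\<^sub>i\<close>, this says
\<open>\<nabla> V\<^sub>1 V\<^sub>2 = (e\<^sub>1 / x\<^sub>3) V\<^sub>3\<close>, \<open>\<nabla> V\<^sub>1 V\<^sub>3 = - (e\<^sub>1 / x\<^sub>2) V\<^sub>2\<close>, \<open>\<nabla> V\<^sub>1 V\<^sub>1 = 0\<close>, and so on cyclically.\<close>

definition milnor_connection :: "(3 \<Rightarrow> real) \<Rightarrow> real^3 \<Rightarrow> real^3 \<Rightarrow> real^3" where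
  "milnor_connection x u v =
     (\<chi> k. cross3 (\<chi> i. ((\<Sum>j\<in>UNIV. x j) - 2 * x i) * u $ i) v $ k / x k)"

lemma bilinear_milnor_connection: "bilinear (milnor_connection x)"
  by (simp add: bilinear_def linear_iff vec_eq_iff forall_3 milnor_connection_def cross_components
      add_divide_distrib diff_divide_distrib algebra_simps)

lemma levi_civita_diagonal:
  assumes h: "so3_frame h" and g: "diagonal_form h x g" and x: "\<And>i. x i > 0"
  shows "levi_civita g X Y = h (milnor_connection x (inv h X) (inv h Y))"
proof -
  note hh = so3_frameD[OF h]
  define D where "D X Y = h (milnor_connection x (inv h X) (inv h Y))" for X Y
  have "x i \<noteq> 0" for i using x[of i] by simp
  note nz = this
  have "bilinear D"
    using hh(1,6) bilinear_milnor_connection[of x] by (simp add: bilinear_def linear_iff D_def)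
  moreover have "D (h u) (h v) - D (h v) (h u) = lie (h u) (h v)" for u v
  proof -
    have "milnor_connection x u v - milnor_connection x v u = 2 *\<^sub>R cross3 u v"
      by (simp add: vec_eq_iff forall_3 milnor_connection_def cross_components nz sum_3 divide_simps)
         (simp add: algebra_simps)
    then show ?thesis
      by (simp add: D_def hh linear_diff[OF hh(1), symmetric] linear_scale[OF hh(1), symmetric])
  qed
  then have "D X Y - D Y X = lie X Y" for X Y by (metis hh(5))
  moreover have "g (D (h u) (h v)) (h w) + g (h v) (D (h u) (h w)) = 0" for u v w
    using g by (simp add: D_def hh diagonal_form_def milnor_connection_def cross_components nz sum_3)
       (simp add: algebra_simps)
  then have "g (D X Y) Z + g Y (D X Z) = 0" for X Y Z by (metis hh(5))
  ultimately have D: "is_levi_civita g D"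
    by (simp add: is_levi_civita_def)
  have "left_inv_metric g" using diagonal_form_metric[OF h g] x by blast
  then have "levi_civita g = D"
    unfolding levi_civita_def using D levi_civita_unique by blast
  then show ?thesis by (simp add: D_def)
qed

text \<open>A form of \<open>2 e\<^sub>j e\<^sub>k / (x\<^sub>j x\<^sub>k)\<close>, for the three distinct indices \<open>i, j, k\<close>, whose dependence on \<open>i\<close>
needs no case distinction. The product form is \<open>ricci_eigenvalue_product\<close> below.\<close>

definition ricci_eigenvalue :: "(3 \<Rightarrow> real) \<Rightarrow> 3 \<Rightarrow> real" where
  "ricci_eigenvalue x i =
     8 - 2 * (\<Sum>j\<in>UNIV. x j) * x i * ((\<Sum>j\<in>UNIV. x j) - 2 * x i) / (x 1 * x 2 * x 3)"

lemma ricci_diagonal: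
  assumes h: "so3_frame h" and g: "diagonal_form h x g" and x: "\<And>i. x i > 0"
  shows "diagonal_form h (ricci_eigenvalue x) (ricci g)"
  unfolding diagonal_form_def
proof (intro allI)
  fix v w :: "real^3"
  note hh = so3_frameD[OF h]
  have nz: "x i \<noteq> 0" for i using x[of i] by simp
  define R where "R u = milnor_connection x u (milnor_connection x v w)
     - milnor_connection x v (milnor_connection x u w)
     - milnor_connection x (2 *\<^sub>R cross3 u v) w" for u
  have rie: "riemann g X (h v) (h w) = h (R (inv h X))" for X
    using hh(3)[of "inv h X" v]
    by (simp add: riemann_def Let_def levi_civita_diagonal[OF h g x] hh R_def linear_diff[OF hh(1)] linear_scale[OF hh(6)])
  note mc = bilinear_milnor_connection[of x]
  have "linear R"
    by (rule linearI) (simp_all add: R_def bilinear_ladd[OF mc] bilinear_radd[OF mc]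
        bilinear_lmul[OF mc] bilinear_rmul[OF mc] cross_add_left cross_mult_left
        scaleR_add_right scaleR_diff_right scaleR_left_commute[of _ 2] add_diff_add)
  then have "linear (\<lambda>X. riemann g X (h v) (h w))"
    using hh(1,6) by (simp add: rie linear_iff)
  then have "ricci g (h v) (h w) = (\<Sum>i\<in>UNIV. R (axis i 1) $ i)"
    by (simp add: ricci_def endo_trace_frame[OF h] rie hh)
  also have "\<dots> = (\<Sum>i\<in>UNIV. ricci_eigenvalue x i * v $ i * w $ i)"
    by (simp add: R_def milnor_connection_def cross_components axis_def nz sum_3 ricci_eigenvalue_def divide_simps)
      (simp add: algebra_simps)
  finally show "ricci g (h v) (h w) = (\<Sum>i\<in>UNIV. ricci_eigenvalue x i * v $ i * w $ i)" .
qed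

section \<open>Diagonalisation in frames\<close>

text \<open>The usual step of the spectral theorem: \<open>v\<close> maximises the quadratic form on the unit sphere of \<open>S\<close>,
so its first variation in the directions orthogonal to \<open>v\<close> vanishes. It is applied first to the whole
space and then to the orthogonal complement of the first eigenvector.\<close>

lemma symmetric_form_maximiser:
  fixes B :: "'a::euclidean_space \<Rightarrow> 'a \<Rightarrow> real"
  assumes B: "bilinear B" "\<And>u v. B u v = B v u" and S: "subspace S" "w \<in> S" "w \<noteq> 0"
  obtains v where "v \<in> S" "norm v = 1" "\<And>u. u \<in> S \<Longrightarrow> u \<bullet> v = 0 \<Longrightarrow> B v u = 0"
proof -
  have "continuous_on (sphere 0 1 \<inter> S) (\<lambda>v. B v v)"
    using B(1) bounded_bilinear.continuous_on[of B _ "\<lambda>v. v" "\<lambda>v. v"]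
    by (simp add: bilinear_conv_bounded_bilinear)
  moreover have "compact (sphere 0 1 \<inter> S)"
    using S(1) by (simp add: compact_Int_closed closed_subspace)
  moreover have "(1 / norm w) *\<^sub>R w \<in> sphere 0 1 \<inter> S"
    using S by (simp add: subspace_scale)
  then have "sphere 0 1 \<inter> S \<noteq> {}" by blast
  ultimately have "\<exists>v\<in>sphere 0 1 \<inter> S. \<forall>u\<in>sphere 0 1 \<inter> S. B u u \<le> B v v"
    by (intro continuous_attains_sup)
  then obtain v where v: "v \<in> S" "norm v = 1"
    and max: "\<And>u. u \<in> S \<Longrightarrow> norm u = 1 \<Longrightarrow> B u u \<le> B v v" by auto
  have le: "B u u \<le> B v v * (u \<bullet> u)" if "u \<in> S" for u
  proof (cases "u = 0")
    case True
    then show ?thesis using B(1) by (simp add: bilinear_lzero)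
  next
    case False
    have "B ((1 / norm u) *\<^sub>R u) ((1 / norm u) *\<^sub>R u) \<le> B v v"
      using that False S(1) by (intro max) (simp_all add: subspace_scale)
    then show ?thesis
      using False by (simp add: bilinear_lmul[OF B(1)] bilinear_rmul[OF B(1)] field_simps
          power2_norm_eq_inner[symmetric] power2_eq_square)
  qed
  have "B v u = 0" if u: "u \<in> S" "u \<bullet> v = 0" for u
  \<comment> \<open>Otherwise moving from \<open>v\<close> by a small multiple of \<open>u\<close>, with the sign of \<open>B v u\<close>, increases the
     quotient \<open>B v v / (v \<bullet> v)\<close>: the gain is of first order in \<open>r\<close>, the loss of second order.\<close>
  proof (rule ccontr)
    assume nz: "B v u \<noteq> 0"
    define m where "m = \<bar>B v v * (u \<bullet> u) - B u u\<bar> + 1"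
    define r where "r = B v u / m"
    have m: "m > 0" "B v v * (u \<bullet> u) - B u u < m" by (auto simp: m_def)
    have "v + r *\<^sub>R u \<in> S" using u v S(1) by (simp add: subspace_add subspace_scale)
    from le[OF this] have "2 * r * B v u \<le> r\<^sup>2 * (B v v * (u \<bullet> u) - B u u)"
      using v(2) u(2) by (simp add: bilinear_ladd[OF B(1)] bilinear_radd[OF B(1)]
          bilinear_lmul[OF B(1)] bilinear_rmul[OF B(1)] B(2)[of u v] inner_add inner_commute[of v u]
          power2_eq_square algebra_simps norm_eq_1)
    also have "\<dots> \<le> r\<^sup>2 * m" using m(2) by (intro mult_left_mono) auto
    finally have "2 * (B v u)\<^sup>2 \<le> (B v u)\<^sup>2"
      using m(1) by (simp add: r_def power2_eq_square field_simps)
    then show False using nz by simp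
  qed
  with v that show thesis by blast
qed

text \<open>Taking \<open>cross3 a b\<close> as the third vector makes the orthonormal
basis positively oriented, so the rotation preserves cross products.\<close>

lemma so3_frame_rotate:
  assumes h: "so3_frame h" and a: "norm a = 1" and b: "norm b = 1" and ab: "a \<bullet> b = 0"
  shows "so3_frame (\<lambda>u. h (u$1 *\<^sub>R a + u$2 *\<^sub>R b + u$3 *\<^sub>R cross3 a b))"
proof -
  define r where "r u = u$1 *\<^sub>R a + u$2 *\<^sub>R b + u$3 *\<^sub>R cross3 a b" for u :: "real^3"
  note hh = so3_frameD[OF h]
  have n: "a \<bullet> a = 1" "b \<bullet> b = 1" "b \<bullet> a = 0" "cross3 a b \<bullet> cross3 a b = 1"
    using a b ab by (simp_all add: norm_eq_1 inner_commute dot_cross)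
  have lin: "linear r"
    by (rule linearI) (simp_all add: r_def algebra_simps)
  have coords: "u = vector [r u \<bullet> a, r u \<bullet> b, r u \<bullet> cross3 a b]" for u
    using n ab by (simp add: r_def inner_add_left dot_cross_self vec_eq_iff forall_3)
  have "inj r"
  proof (rule injI)
    fix u v assume eq: "r u = r v"
    show "u = v" by (subst coords[of u], subst coords[of v]) (simp add: eq)
  qed
  then have "bij r"
    using linear_injective_imp_surjective[OF lin] by (simp add: bij_def)
  have c: "cross3 b (cross3 a b) = a" "cross3 (cross3 a b) a = b"
    "cross3 (cross3 a b) b = - a" "cross3 a (cross3 a b) = - b" "cross3 b a = - cross3 a b"
    using n ab cross_skew[of "cross3 a b"] cross_skew[of b a] by (simp_all add: Lagrange)
  have "cross3 (r u) (r v) = r (cross3 u v)" for u v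
    by (simp add: r_def cross_add_left cross_add_right cross_mult_left cross_mult_right c
        cross_components algebra_simps)
  moreover have "bij (\<lambda>u. h (r u))"
    using bij_comp[OF \<open>bij r\<close> hh(2)] by (simp add: o_def)
  moreover have "linear (\<lambda>u. h (r u))"
    using linear_compose[OF lin hh(1)] by (simp add: o_def)
  ultimately show ?thesis
    unfolding r_def[symmetric] using hh(3) by (simp add: so3_frame_def)
qed

lemma diagonalising_frame:
  assumes B: "bilinear B" "\<And>X Y. B X Y = B Y X"
  obtains h x where "so3_frame h" "diagonal_form h x B"
proof -
  obtain k where k: "so3_frame k" using so3_frame_exists by blast
  note kk = so3_frameD[OF k]
  define F where "F u v = B (k u) (k v)" for u v
  have F: "bilinear F" "\<And>u v. F u v = F v u"
    using B kk(1) by (simp_all add: F_def bilinear_def linear_iff)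
  obtain a where a: "norm a = 1" "\<And>u. u \<bullet> a = 0 \<Longrightarrow> F a u = 0"
    using symmetric_form_maximiser[OF F, of UNIV "axis 1 1"] by (auto simp: axis_eq_0_iff)
  have "\<exists>w::real^3. w \<noteq> 0 \<and> orthogonal a w"
    using orthogonal_to_vector_exists[of a] by auto
  then obtain w where "w \<noteq> 0" "a \<bullet> w = 0" by (auto simp: orthogonal_def)
  then obtain b where b: "a \<bullet> b = 0" "norm b = 1"
    "\<And>u. a \<bullet> u = 0 \<Longrightarrow> u \<bullet> b = 0 \<Longrightarrow> F b u = 0"
    using symmetric_form_maximiser[OF F, of "{u. a \<bullet> u = 0}" w]
    by (auto simp: subspace_hyperplane)
  define c where "c = cross3 a b"
  have c: "F a b = 0" "F a c = 0" "F b c = 0" "F b a = 0" "F c a = 0" "F c b = 0"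
    using a(2)[of b] a(2)[of c] b(1) b(3)[of c] F(2)
    by (simp_all add: c_def dot_cross_self inner_commute)
  define h where "h u = k (u$1 *\<^sub>R a + u$2 *\<^sub>R b + u$3 *\<^sub>R c)" for u :: "real^3"
  have "diagonal_form h (\<lambda>i. if i = 1 then F a a else if i = 2 then F b b else F c c) B"
    unfolding diagonal_form_def h_def F_def[symmetric]
    by (simp add: sum_3 c bilinear_ladd[OF F(1)] bilinear_radd[OF F(1)]
        bilinear_lmul[OF F(1)] bilinear_rmul[OF F(1)] algebra_simps)
  moreover have "so3_frame h"
    unfolding h_def c_def by (rule so3_frame_rotate[OF k a(1) b(2,1)])
  ultimately show thesis using that by blast
qed

text \<open>A transposition of basis vectors reverses the orientation and would change the sign of the bracket.
The new frame therefore also reverses one vector, to which diagonal entries are insensitive.\<close>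

lemma diagonal_form_swap:
  assumes h: "so3_frame h" and ij: "(i, j) = (1, 2) \<or> (i, j) = (2, 3)"
  obtains k where "so3_frame k"
    "\<And>x B. diagonal_form h x B \<Longrightarrow> diagonal_form k (x(i := x j, j := x i)) B"
proof (cases "(i, j) = (1, 2)")
  case True
  define k where "k u = h (u$1 *\<^sub>R axis 2 1 + u$2 *\<^sub>R axis 1 1 + u$3 *\<^sub>R cross3 (axis 2 1) (axis 1 1))"
    for u :: "real^3"
  have "so3_frame k"
    unfolding k_def by (rule so3_frame_rotate[OF h]) (simp_all add: inner_axis_axis)
  moreover have "diagonal_form k (x(i := x j, j := x i)) B" if "diagonal_form h x B" for x B
    using that True by (simp add: diagonal_form_def k_def sum_3 cross_components axis_def)
  ultimately show thesis using that by blast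
next
  case False
  with ij have ij: "i = 2" "j = 3" by auto
  define k where "k u = h (u$1 *\<^sub>R axis 1 1 + u$2 *\<^sub>R axis 3 1 + u$3 *\<^sub>R cross3 (axis 1 1) (axis 3 1))"
    for u :: "real^3"
  have "so3_frame k"
    unfolding k_def by (rule so3_frame_rotate[OF h]) (simp_all add: inner_axis_axis)
  moreover have "diagonal_form k (x(i := x j, j := x i)) B" if "diagonal_form h x B" for x B
    using that by (simp add: ij diagonal_form_def k_def sum_3 cross_components axis_def)
  ultimately show thesis using that by blast
qed

lemma diagonal_form_sort:
  assumes h: "so3_frame h" "diagonal_form h x g" "diagonal_form h t T"
  obtains k y s where "so3_frame k" "diagonal_form k y g" "diagonal_form k s T" "s 1 \<ge> s 2" "s 2 \<ge> s 3"
proof -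
  define P where "P a b c \<longleftrightarrow> (\<exists>k y s. so3_frame k \<and> diagonal_form k y g \<and> diagonal_form k s T \<and>
      s 1 = a \<and> s 2 = b \<and> s 3 = c)" for a b c
  have 12: "P b a c" if "P a b c" for a b c
  proof -
    from that obtain k y s where k: "so3_frame k" "diagonal_form k y g" "diagonal_form k s T"
      "s 1 = a" "s 2 = b" "s 3 = c" by (auto simp: P_def)
    show ?thesis
      unfolding P_def
      by (rule diagonal_form_swap[OF k(1), of 1 2], simp)
        (intro exI[of _ "s(1 := s 2, 2 := s 1)"] exI conjI, auto intro: k)
  qed
  have 23: "P a c b" if "P a b c" for a b c
  proof -
    from that obtain k y s where k: "so3_frame k" "diagonal_form k y g" "diagonal_form k s T"
      "s 1 = a" "s 2 = b" "s 3 = c" by (auto simp: P_def)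
    show ?thesis
      unfolding P_def
      by (rule diagonal_form_swap[OF k(1), of 2 3], simp)
        (intro exI[of _ "s(2 := s 3, 3 := s 2)"] exI conjI, auto intro: k)
  qed
  have "P (t 1) (t 2) (t 3)" using h by (auto simp: P_def)
  then have "\<exists>a b c. P a b c \<and> a \<ge> b \<and> b \<ge> c"
    by (metis 12 23 linear)
  then show thesis using that by (auto simp: P_def)
qed

text \<open>Both sides are \<open>T\<close> evaluated at the \<open>i\<close>-th vector of \<open>h\<close> and the \<open>j\<close>-th vector of \<open>k\<close>. In other
words, the isometry that relates the two frames intertwines the two diagonal matrices.\<close>

lemma diagonal_form_transfer_eigenvalue:
  assumes h: "so3_frame h" "diagonal_form h t T" and k: "so3_frame k" "diagonal_form k s T"
  shows "t i * inv k (h (axis i 1)) $ j = s j * inv k (h (axis i 1)) $ j"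
proof -
  note hh = so3_frameD[OF h(1)] and kk = so3_frameD[OF k(1)]
  have "inv h (k (axis j 1)) $ i = inv k (h (axis i 1)) $ j"
    using so3_frame_isometry[OF h(1) k(1), of "axis i 1" "inv h (k (axis j 1))"]
    by (simp add: hh kk inner_axis inner_axis')
  moreover have "T (h (axis i 1)) (k (axis j 1)) = t i * inv h (k (axis j 1)) $ i"
    using h(2)[unfolded diagonal_form_def, rule_format, of "axis i 1" "inv h (k (axis j 1))"]
    by (simp add: hh axis_def if_distrib if_distribR cong: if_cong)
  moreover have "T (h (axis i 1)) (k (axis j 1)) = s j * inv k (h (axis i 1)) $ j"
    using k(2)[unfolded diagonal_form_def, rule_format, of "inv k (h (axis i 1))" "axis j 1"]
    by (simp add: kk axis_def if_distrib if_distribR cong: if_cong)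
  ultimately show ?thesis by (metis (no_types))
qed

lemma diagonal_form_common_eigenvalue:
  assumes h: "so3_frame h" "diagonal_form h t T" and k: "so3_frame k" "diagonal_form k s T"
  obtains j where "inv k (h (axis i 1)) $ j \<noteq> 0" "s j = t i"
proof -
  have "inv k (h (axis i 1)) \<bullet> inv k (h (axis i 1)) = 1"
    by (simp add: so3_frame_isometry[OF h(1) k(1)] inner_axis')
  then have "inv k (h (axis i 1)) \<noteq> 0" by auto
  then obtain j where "inv k (h (axis i 1)) $ j \<noteq> 0" by (auto simp: vec_eq_iff)
  then show thesis using that diagonal_form_transfer_eigenvalue[OF h k, of i j] by auto
qed

text \<open>The isometry that relates \<open>h\<close> and \<open>k\<close> maps eigenspaces of \<open>T\<close> to eigenspaces of \<open>T\<close>. By the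
assumption \<open>inj\<close> the form \<open>g\<close> is a multiple of the inner product on each of them, so
it is diagonal in every eigenframe of \<open>T\<close>.\<close>

lemma diagonal_form_transfer:
  assumes h: "so3_frame h" "diagonal_form h t T" and k: "so3_frame k" "diagonal_form k s T"
    and g: "diagonal_form k x g" and inj: "\<And>i j. s i = s j \<Longrightarrow> x i = x j"
  obtains y where "diagonal_form h y g"
proof -
  note hh = so3_frameD[OF h(1)] and kk = so3_frameD[OF k(1)]
  define A where "A i j = inv k (h (axis i 1)) $ j" for i j
  have "\<exists>j. s j = t i" for i
    using diagonal_form_common_eigenvalue[OF h k] by metis
  then obtain n where n: "\<And>i. s (n i) = t i" by metis
  define y where "y i = x (n i)" for i
  have yx: "A i j * y i = A i j * x j" for i j
  proof (cases "A i j = 0")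
    case False
    then have "s j = s (n i)"
      using diagonal_form_transfer_eigenvalue[OF h k, of i j] n by (simp add: A_def)
    then show ?thesis using inj[of j "n i"] by (simp add: y_def)
  qed simp
  have lin: "linear (\<lambda>u. inv k (h u))"
    using linear_compose[OF hh(1) kk(6)] by (simp add: o_def)
  have M: "inv k (h u) $ j = (\<Sum>i\<in>UNIV. u $ i * A i j)" for u j
    by (subst linear_eq_sum_axis[OF lin]) (simp add: A_def)
  have L: "inv k (h (\<chi> i. y i * u $ i)) = (\<chi> j. x j * inv k (h u) $ j)" for u
  proof -
    have "y i * u $ i * A i j = x j * (u $ i * A i j)" for i j
      using yx[of i j] by algebra
    then show ?thesis
      unfolding vec_eq_iff M sum_distrib_left by (auto intro!: sum.cong)
  qed
  have "g (h u) (h v) = (\<Sum>i\<in>UNIV. y i * u $ i * v $ i)" for u v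
  proof -
    have "g (h u) (h v) = (\<chi> j. x j * inv k (h u) $ j) \<bullet> inv k (h v)"
      using g[unfolded diagonal_form_def, rule_format, of "inv k (h u)" "inv k (h v)"]
      by (simp add: kk inner_vec_def)
    also have "\<dots> = (\<chi> i. y i * u $ i) \<bullet> v"
      by (simp add: L[symmetric] so3_frame_isometry[OF h(1) k(1)])
    finally show ?thesis by (simp add: inner_vec_def)
  qed
  then show thesis using that by (auto simp: diagonal_form_def)
qed

section \<open>Prescribed Ricci eigenvalues and roots of the cubic\<close>

lemma ricci_eigenvalue_product:
  assumes x: "\<And>i. x i > 0"
  defines "e i \<equiv> (\<Sum>j\<in>UNIV. x j) - 2 * x i"
  shows "ricci_eigenvalue x 1 * (x 2 * x 3) = 2 * e 2 * e 3"
    "ricci_eigenvalue x 2 * (x 3 * x 1) = 2 * e 3 * e 1"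
    "ricci_eigenvalue x 3 * (x 1 * x 2) = 2 * e 1 * e 2"
  using x[of 1] x[of 2] x[of 3]
  by (simp_all add: ricci_eigenvalue_def sum_3 e_def field_simps)

text \<open>One of the factors \<open>e\<^sub>j\<close> vanishes. It occurs in both
eigenvalues other than the \<open>j\<close>-th, and removes the second summand of the \<open>j\<close>-th.\<close>

lemma ricci_eigenvalue_zero:
  assumes x: "\<And>i. x i > 0" and z: "ricci_eigenvalue x i = 0"
  obtains j where "ricci_eigenvalue x j = 8" "\<forall>k. k \<noteq> j \<longrightarrow> ricci_eigenvalue x k = 0"
proof -
  define e where "e i = (\<Sum>j\<in>UNIV. x j) - 2 * x i" for i
  note r = ricci_eigenvalue_product[of x, OF x, folded e_def]
  have nz: "x i \<noteq> 0" for i using x[of i] by simp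
  have "\<exists>j. e j = 0"
    using r exhaust_3[of i] z by auto
  then obtain j where j: "e j = 0" by blast
  have "ricci_eigenvalue x j = 8"
    using j by (simp add: ricci_eigenvalue_def e_def)
  moreover have "ricci_eigenvalue x k = 0" if "k \<noteq> j" for k
    using exhaust_3[of k] exhaust_3[of j] that j r nz by auto
  ultimately show thesis using that by blast
qed

text \<open>The quotients \<open>t i / (p + t i)\<close> are, up to a common factor, the diagonal entries of the metric that
belongs to the root \<open>p\<close>; hence their positivity.\<close>

definition admissible_root :: "(3 \<Rightarrow> real) \<Rightarrow> real \<Rightarrow> bool" where
  "admissible_root t p \<longleftrightarrow> fbar t p = 0 \<and> p \<noteq> 0 \<and> (\<forall>i. t i / (p + t i) > 0)"

lemma fbar_eq_0_iff:
  assumes "\<And>i. p + t i \<noteq> 0"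
  shows "fbar t p = 0 \<longleftrightarrow> (\<Sum>i\<in>UNIV. t i / (p + t i)) = 2"
proof -
  have "(\<Sum>i\<in>UNIV. t i / (p + t i)) =
      (t 1 * (p + t 2) * (p + t 3) + t 2 * (p + t 1) * (p + t 3) + t 3 * (p + t 1) * (p + t 2))
        / ((p + t 1) * (p + t 2) * (p + t 3))"
    using assms by (simp add: sum_3 add_divide_distrib)
  also have "\<dots> = 2 - fbar t p / ((p + t 1) * (p + t 2) * (p + t 3))"
  proof -
    have "t 1 * (p + t 2) * (p + t 3) + t 2 * (p + t 1) * (p + t 3) + t 3 * (p + t 1) * (p + t 2)
        = 2 * ((p + t 1) * (p + t 2) * (p + t 3)) - fbar t p"
      unfolding fbar_def by algebra
    then show ?thesis using assms by (simp add: diff_divide_distrib)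
  qed
  finally show ?thesis using assms by simp
qed

text \<open>The three equations \<open>c t\<^sub>i x\<^sub>j x\<^sub>k = 2 e\<^sub>j e\<^sub>k\<close> say that \<open>t\<^sub>i e\<^sub>i / x\<^sub>i\<close> is the same number \<open>2 p\<close> for all \<open>i\<close>.
This is solved for \<open>x\<^sub>i\<close>, and the sum of the \<open>x\<^sub>i\<close> gives the cubic. The product of the three
numbers gives \<open>c\<close>.\<close>

lemma ricci_eigenvalue_imp_root:
  assumes x: "\<And>i. x i > 0" and c: "c > 0" and t: "\<And>i. t i \<noteq> 0"
    and r: "\<And>i. ricci_eigenvalue x i = c * t i"
  obtains p where "admissible_root t p" "c * (t 1 * t 2 * t 3) = 8 * p\<^sup>2"
    "\<forall>i. x i = (\<Sum>j\<in>UNIV. x j) / 2 * (t i / (p + t i))"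
proof -
  define s where "s = (\<Sum>j\<in>UNIV. x j)"
  define e where "e i = s - 2 * x i" for i
  have s: "s > 0" unfolding s_def using x by (intro sum_pos) auto
  have nz: "x i \<noteq> 0" for i using x[of i] by simp
  note prod = ricci_eigenvalue_product[of x, OF x, folded s_def, folded e_def, unfolded r]
  have e: "e i \<noteq> 0" for i
    using exhaust_3[of i] prod c t nz by auto
  define p where "p = e 1 * e 2 * e 3 / (c * (x 1 * x 2 * x 3))"
  have p: "p \<noteq> 0" using e c nz by (simp add: p_def)
  have te: "t i * e i = 2 * p * x i" for i
    using exhaust_3[of i] prod c nz by (auto simp: p_def field_simps)
  have ts: "2 * (p + t i) * x i = t i * s" for i
    using te[of i] by (simp add: e_def algebra_simps)
  have pt: "p + t i \<noteq> 0" for i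
  proof
    assume "p + t i = 0"
    with ts[of i] have "t i * s = 0" by simp
    then show False using t[of i] s by simp
  qed
  have xi: "x i = s / 2 * (t i / (p + t i))" for i
    using ts[of i] pt[of i] by (simp add: field_simps)
  have pos: "t i / (p + t i) > 0" for i
  proof -
    have "0 < s / 2 * (t i / (p + t i))" using x[of i] xi[of i] by simp
    then show ?thesis using s by (simp only: zero_less_mult_iff) auto
  qed
  have "s / 2 * (\<Sum>i\<in>UNIV. t i / (p + t i)) = s"
    by (simp only: sum_distrib_left xi[symmetric]) (simp add: s_def)
  then have "fbar t p = 0"
    using s by (simp add: fbar_eq_0_iff[OF pt])
  then have "admissible_root t p" using p pos by (simp add: admissible_root_def)
  moreover have "c * (t 1 * t 2 * t 3) = 8 * p\<^sup>2"
  proof -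
    have "p * (c * (x 1 * x 2 * x 3)) = e 1 * e 2 * e 3"
      using c nz by (simp add: p_def)
    moreover have "(t 1 * e 1) * (t 2 * e 2) * (t 3 * e 3) = 8 * p ^ 3 * (x 1 * x 2 * x 3)"
      by (simp add: te power3_eq_cube)
    ultimately have "(c * (t 1 * t 2 * t 3) - 8 * p\<^sup>2) * (p * (x 1 * x 2 * x 3)) = 0"
      by algebra
    then show ?thesis using p nz by auto
  qed
  ultimately show thesis
    by (rule that[OF _ _ allI[OF xi[unfolded s_def]]])
qed

text \<open>Converse of the previous lemma, with the scaling for which the diagonal entries have sum 2, so
that \<open>e\<^sub>i = 2 p / (p + t i)\<close>.\<close>

lemma root_imp_ricci_eigenvalue:
  assumes p: "admissible_root t p" and t: "t 1 * t 2 * t 3 > 0"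
  shows "ricci_eigenvalue (\<lambda>i. t i / (p + t i)) i = 8 * p\<^sup>2 / (t 1 * t 2 * t 3) * t i"
proof -
  have nz: "t i \<noteq> 0" "p + t i \<noteq> 0" for i
    using p unfolding admissible_root_def by (metis divide_eq_0_iff less_irrefl)+
  have f: "2 * p^3 + (t 1 + t 2 + t 3) * p^2 - t 1 * t 2 * t 3 = 0"
    using p by (simp add: admissible_root_def fbar_def)
  have S: "(\<Sum>j\<in>UNIV. t j / (p + t j)) = 2"
    using p fbar_eq_0_iff[OF nz(2)] by (simp add: admissible_root_def)
  have "2 - 2 * (t i / (p + t i)) = 2 * p / (p + t i)"
    using nz(2)[of i] by (simp add: field_simps)
  then have "ricci_eigenvalue (\<lambda>i. t i / (p + t i)) i =
      8 - 8 * (t i * p / (p + t i)\<^sup>2) / (t 1 / (p + t 1) * (t 2 / (p + t 2)) * (t 3 / (p + t 3)))"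
    unfolding ricci_eigenvalue_def S by (simp add: power2_eq_square)
  also have "\<dots> = 8 - 8 * (t i * p * ((p + t 1) * (p + t 2) * (p + t 3))) / ((p + t i)\<^sup>2 * (t 1 * t 2 * t 3))"
    using nz by simp
  also have "\<dots> = 8 * p\<^sup>2 / (t 1 * t 2 * t 3) * t i"
  proof -
    have "(p + t i)\<^sup>2 * (t 1 * t 2 * t 3) - t i * p * ((p + t 1) * (p + t 2) * (p + t 3)) =
        p\<^sup>2 * t i * (p + t i)\<^sup>2"
    proof -
      consider "i = 1" | "i = 2" | "i = 3" using exhaust_3 by blast
      then show ?thesis
      proof cases
        case 1
        show ?thesis unfolding 1 using f by algebra
      next
        case 2
        show ?thesis unfolding 2 using f by algebra
      next
        case 3
        show ?thesis unfolding 3 using f by algebra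
      qed
    qed
    moreover have aux: "8 - 8 * b / (c * e) = 8 * a / e * d"
      if "c * e - b = a * d * c" "c \<noteq> 0" "e \<noteq> 0" for a b c d e :: real
    proof -
      have "8 * b = 8 * (c * e) - 8 * (a * d * c)" using that(1) by simp
      then show ?thesis using that(2,3) by (simp add: diff_divide_distrib)
    qed
    from aux[of "(p + t i)\<^sup>2" "t 1 * t 2 * t 3" "t i * p * ((p + t 1) * (p + t 2) * (p + t 3))" "p\<^sup>2" "t i"]
      calculation nz(2)[of i] nz(1)[of 1] nz(1)[of 2] nz(1)[of 3] show ?thesis by simp
  qed
  finally show ?thesis .
qed

section \<open>Counting admissible roots\<close>

lemma fbar_IVT:
  assumes "a \<le> b" "fbar t a * fbar t b \<le> 0"
  obtains p where "a \<le> p" "p \<le> b" "fbar t p = 0"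
proof -
  have cont: "continuous_on {a..b} (fbar t)"
    unfolding fbar_def by (intro continuous_intros)
  have "(fbar t a \<le> 0 \<and> fbar t b \<ge> 0) \<or> (fbar t a \<ge> 0 \<and> fbar t b \<le> 0)"
    using assms(2) by (auto simp: mult_le_0_iff)
  then have "\<exists>p\<ge>a. p \<le> b \<and> fbar t p = 0"
    using IVT'[OF _ _ assms(1) cont, of 0] IVT2'[OF _ _ assms(1) cont, of 0] by blast
  then show thesis using that by blast
qed

lemma admissible_root_positive:
  assumes t: "\<And>i. t i > 0"
  shows "admissible_root t p \<longleftrightarrow> fbar t p = 0 \<and> p > 0"
proof
  assume p: "admissible_root t p"
  have pt: "p + t i > 0" for i
  proof -
    have "t i / (p + t i) > 0" using p by (simp add: admissible_root_def)
    then show ?thesis using t[of i] by (simp add: zero_less_divide_iff)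
  qed
  have "p > 0"
  proof (rule ccontr)
    assume "\<not> p > 0"
    moreover have "p \<noteq> 0" using p by (simp add: admissible_root_def)
    ultimately have n: "p < 0" by linarith
    \<comment> \<open>Expansion in the variables \<open>p + t i\<close>, whose signs are known.\<close>
    have "fbar t p = p * ((p + t 1) * (p + t 2) + (p + t 2) * (p + t 3) + (p + t 1) * (p + t 3))
        - (p + t 1) * (p + t 2) * (p + t 3)"
      by (simp add: fbar_def power2_eq_square power3_eq_cube algebra_simps)
    moreover have "p * ((p + t 1) * (p + t 2) + (p + t 2) * (p + t 3) + (p + t 1) * (p + t 3)) < 0"
      using n by (rule mult_neg_pos) (intro add_pos_pos mult_pos_pos pt)
    moreover have "(p + t 1) * (p + t 2) * (p + t 3) > 0"
      using pt by (intro mult_pos_pos)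
    ultimately show False using p by (simp add: admissible_root_def)
  qed
  then show "fbar t p = 0 \<and> p > 0" using p by (simp add: admissible_root_def)
next
  assume p: "fbar t p = 0 \<and> p > 0"
  then show "admissible_root t p" using t by (simp add: admissible_root_def add_pos_pos)
qed

text \<open>On the positive numbers \<open>fbar\<close> increases strictly, and it is negative at 0 and, since
\<open>t 1 t 2 t 3 \<le> m\<^sup>3\<close> for the sum \<open>m\<close> of the \<open>t i\<close>, nonnegative at \<open>m\<close>.\<close>

lemma admissible_root_positive_ex1:
  assumes t: "\<And>i. t i > 0"
  shows "\<exists>!p. admissible_root t p"
proof -
  define m where "m = t 1 + t 2 + t 3"
  have m: "t 1 \<le> m" "t 2 \<le> m" "t 3 \<le> m" "m > 0"
    using t[of 1] t[of 2] t[of 3] by (simp_all add: m_def)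
  have fbar: "fbar t p = 2 * p ^ 3 + m * p\<^sup>2 - t 1 * t 2 * t 3" for p
    by (simp add: fbar_def m_def)
  have neg: "fbar t 0 < 0" using t by (simp add: fbar)
  have "t 1 * t 2 * t 3 \<le> m * m * m"
    using m t[of 1] t[of 2] t[of 3] by (intro mult_mono) simp_all
  moreover have "fbar t m = 3 * (m * m * m) - t 1 * t 2 * t 3"
    by (simp add: fbar power2_eq_square power3_eq_cube)
  moreover have "m * m * m > 0" using m(4) by simp
  ultimately have "fbar t m \<ge> 0" by linarith
  with neg have "fbar t 0 * fbar t m \<le> 0" by (intro mult_nonpos_nonneg) simp_all
  then obtain p where p: "0 \<le> p" "p \<le> m" "fbar t p = 0"
    by (rule fbar_IVT[OF less_imp_le[OF m(4)]])
  have pos: "p > 0"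
  proof (rule ccontr)
    assume "\<not> p > 0"
    then have "p = 0" using p(1) by simp
    then show False using p(3) neg by simp
  qed
  have mono: "fbar t q < fbar t r" if "0 < q" "q < r" for q r
  proof -
    have "q ^ 3 < r ^ 3" "q\<^sup>2 < r\<^sup>2" using that by (simp_all add: power_strict_mono)
    then show ?thesis using m(4) by (simp add: fbar add_strict_mono)
  qed
  show ?thesis
  proof (rule ex1I)
    show "admissible_root t p" using p(3) pos by (simp add: admissible_root_positive[OF t])
  next
    fix q assume "admissible_root t q"
    then have q: "fbar t q = 0" "q > 0" by (simp_all add: admissible_root_positive[OF t])
    show "q = p"
    proof (cases q p rule: linorder_cases)
      case less
      then show ?thesis using mono[OF q(2) less] p(3) q(1) by simp
    next
      case greater
      then show ?thesis using mono[OF pos greater] p(3) q(1) by simp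
    qed
  qed
qed

text \<open>Taylor expansion at the critical point \<open>- m / 3\<close>, where \<open>m\<close> is the sum of the \<open>t i\<close>. If \<open>m > 0\<close>, it
shows that the critical value bounds \<open>fbar\<close> from above on the negative numbers, strictly away from the critical
point.\<close>

lemma fbar_critical_value:
  "fbar t p = fbar t (- ((t 1 + t 2 + t 3) / 3)) +
     2 * (p + (t 1 + t 2 + t 3) / 3)\<^sup>2 * (p - (t 1 + t 2 + t 3) / 6)"
proof -
  define m where "m = (t 1 + t 2 + t 3) / 6"
  have m: "t 1 + t 2 + t 3 = 6 * m" "(6 * m) / 3 = 2 * m" "(6 * m) / 6 = m"
    by (simp_all add: m_def)
  show ?thesis unfolding fbar_def m by algebra
qed

lemma admissible_root_mixed:
  assumes t: "t 1 > 0" "t 2 < 0" "t 3 < 0"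
  shows "admissible_root t p \<longleftrightarrow> fbar t p = 0 \<and> - t 1 < p \<and> p < 0"
proof
  assume p: "admissible_root t p"
  have p1: "p + t 1 > 0" and p2: "p + t 2 < 0" and p3: "p + t 3 < 0"
    using p t by (auto simp: admissible_root_def zero_less_divide_iff dest: spec[of _ 1] spec[of _ 2] spec[of _ 3])
  have "\<not> p > 0"
  proof
    assume "p > 0"
    have "fbar t p = p * ((p + t 1) * (p + t 2) + (p + t 2) * (p + t 3) + (p + t 1) * (p + t 3))
        - (p + t 1) * (p + t 2) * (p + t 3)"
      by (simp add: fbar_def power2_eq_square power3_eq_cube algebra_simps)
    also have "\<dots> = p * ((p + t 1) * (p + t 2)) + p * ((p + t 1) * (p + t 3)) - t 1 * ((p + t 2) * (p + t 3))"
      by (simp add: algebra_simps)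
    also have "\<dots> < 0"
    proof -
      have "p * ((p + t 1) * (p + t 2)) < 0" "p * ((p + t 1) * (p + t 3)) < 0"
        "t 1 * ((p + t 2) * (p + t 3)) > 0"
        using \<open>p > 0\<close> p1 p2 p3 t by (simp_all add: mult_pos_neg mult_neg_neg)
      then show ?thesis by linarith
    qed
    finally show False using p by (simp add: admissible_root_def)
  qed
  then show "fbar t p = 0 \<and> - t 1 < p \<and> p < 0"
    using p p1 by (auto simp: admissible_root_def)
next
  assume p: "fbar t p = 0 \<and> - t 1 < p \<and> p < 0"
  have "t i / (p + t i) > 0" for i
    using exhaust_3[of i] p t by (auto simp: zero_less_divide_iff)
  with p show "admissible_root t p" by (auto simp: admissible_root_def)
qed

text \<open>A root in \<open>(- t 1, 0)\<close> forces \<open>m > 0\<close> for \<open>m = t 1 + t 2 + t 3\<close>, since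
\<open>fbar t p = p\<^sup>2 (2 p + m) - t 1 t 2 t 3\<close>, and then the critical value is at least \<open>fbar t p = 0\<close>.
Conversely, both alternatives of the condition supply a point of \<open>[- t 1, 0)\<close> where \<open>fbar\<close> is
nonnegative, while \<open>fbar t 0 < 0\<close>.\<close>

lemma admissible_root_mixed_exists_iff:
  assumes t: "t 1 > 0" "t 3 \<le> t 2" "t 2 < 0"
  shows "(\<exists>p. admissible_root t p) \<longleftrightarrow> cond_iii t"
proof -
  define m q where "m = t 1 + t 2 + t 3" and "q = - (m / 3)"
  have t': "t 1 > 0" "t 2 < 0" "t 3 < 0" using t by auto
  note adm = admissible_root_mixed[OF t']
  have e3: "t 1 * t 2 * t 3 > 0" using t' by (simp add: mult_neg_neg mult.assoc)
  have neg0: "fbar t 0 < 0" using e3 by (simp add: fbar_def)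
  have cond: "cond_iii t \<longleftrightarrow> fbar t q \<ge> 0 \<and> q < 0 \<or> fbar t (- t 1) > 0"
    using t by (simp add: cond_iii_def q_def m_def)
  have "- t 1 < q" using t' by (simp add: q_def m_def)
  show ?thesis
  proof
    assume "\<exists>p. admissible_root t p"
    then obtain p where p: "fbar t p = 0" "- t 1 < p" "p < 0" using adm by blast
    have "m > 0"
    proof (rule ccontr)
      assume "\<not> m > 0"
      then have "p\<^sup>2 * (2 * p + m) \<le> 0" using p(3) by (intro mult_nonneg_nonpos) auto
      then have "fbar t p < 0"
        using e3 by (simp add: fbar_def m_def power2_eq_square power3_eq_cube algebra_simps)
      then show False using p(1) by simp
    qed
    have "2 * (p - q)\<^sup>2 * (p - m / 6) \<le> 0"
      using p(3) \<open>m > 0\<close> by (intro mult_nonneg_nonpos) auto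
    moreover have "fbar t p = fbar t q + 2 * (p - q)\<^sup>2 * (p - m / 6)"
      using fbar_critical_value[of t p] by (simp add: q_def m_def)
    ultimately have "fbar t q \<ge> 0" using p(1) by linarith
    then show "cond_iii t" using \<open>m > 0\<close> by (simp add: cond q_def)
  next
    assume "cond_iii t"
    \<comment> \<open>At \<open>- t 1\<close> itself the value must be strictly positive, as the interval is open there.\<close>
    then obtain a where a: "- t 1 \<le> a" "a < 0" "fbar t a \<ge> 0" "a = - t 1 \<longrightarrow> fbar t a > 0"
      using cond \<open>- t 1 < q\<close> t' by (metis less_imp_le neg_less_0_iff_less order_less_irrefl order_refl)
    obtain p where p: "a \<le> p" "p \<le> 0" "fbar t p = 0"
      using fbar_IVT[of a 0 t] a neg0 by (auto simp: mult_le_0_iff)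
    have "p \<noteq> 0" "p \<noteq> - t 1" using p a neg0 by auto
    with p a have "- t 1 < p" "p < 0" by linarith+
    with p adm show "\<exists>p. admissible_root t p" by blast
  qed
qed

text \<open>The product of the three roots of \<open>fbar\<close> is half of \<open>t 1 t 2 t 3 > 0\<close>, so the third root \<open>w\<close> is
positive and not admissible. The factorisation then shows the sign at \<open>- t 1\<close>, which lies to the left
of all roots. The critical value is positive because at least one of \<open>p\<close> and \<open>q\<close> is not the critical
point.\<close>

lemma admissible_root_mixed_two:
  assumes t: "t 1 > 0" "t 2 < 0" "t 3 < 0"
    and p: "admissible_root t p" "admissible_root t q" "p \<noteq> q"
  shows "cond_two_solutions t" "admissible_root t r \<Longrightarrow> r = p \<or> r = q"
proof -
  define m where "m = t 1 + t 2 + t 3"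
  have e3: "t 1 * t 2 * t 3 > 0" using t by (simp add: mult_neg_neg mult.assoc)
  have p': "fbar t p = 0" "- t 1 < p" "p < 0" "fbar t q = 0" "- t 1 < q" "q < 0"
    using p by (simp_all add: admissible_root_mixed[OF t])
  define w where "w = - m / 2 - p - q"
  have 0: "2 * (p\<^sup>2 + p * q + q\<^sup>2) + m * (p + q) = 0"
  proof -
    have "(p - q) * (2 * (p\<^sup>2 + p * q + q\<^sup>2) + m * (p + q)) = fbar t p - fbar t q"
      by (simp add: fbar_def m_def power2_eq_square power3_eq_cube algebra_simps)
    then show ?thesis using p' p(3) by simp
  qed
  have fac: "fbar t z = 2 * (z - p) * (z - q) * (z - w)" for z
  proof -
    have "2 * p^3 + m * p^2 = t 1 * t 2 * t 3" using p'(1) by (simp add: fbar_def m_def)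
    then have "2 * z^3 + m * z^2 - t 1 * t 2 * t 3 = 2 * (z - p) * (z - q) * (z + m / 2 + p + q)"
      using 0 by algebra
    moreover have "fbar t z = 2 * z^3 + m * z^2 - t 1 * t 2 * t 3" "z - w = z + m / 2 + p + q"
      by (simp_all add: fbar_def m_def w_def field_simps)
    ultimately show ?thesis by simp
  qed
  have pq: "p * q > 0" "p + q < 0" using p'(3,6) by (simp_all add: mult_neg_neg)
  define S d where "S = p\<^sup>2 + p * q + q\<^sup>2" and "d = m * (p + q)"
  have "S > 0" unfolding S_def using pq(1) p'(3,6) by (intro add_pos_pos) simp_all
  moreover have "2 * S + d = 0" unfolding S_def d_def by (rule 0)
  ultimately have "d < 0" by linarith
  have m: "m > 0"
  proof (rule ccontr)
    assume "\<not> m > 0"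
    then have "d \<ge> 0" unfolding d_def using pq(2) by (intro mult_nonpos_nonpos) simp_all
    then show False using \<open>d < 0\<close> by simp
  qed
  have w: "w > 0"
  proof -
    have "fbar t 0 = - (t 1 * t 2 * t 3)" by (simp add: fbar_def)
    moreover have "fbar t 0 = - (2 * (p * q) * w)" unfolding fac by simp
    ultimately have "2 * (p * q) * w = t 1 * t 2 * t 3" by (simp only: neg_equal_iff_equal)
    with e3 have "2 * (p * q) * w > 0" by (simp only:)
    moreover have "2 * (p * q) > 0" using pq(1) by simp
    ultimately show ?thesis by (rule zero_less_mult_pos)
  qed
  show "r = p \<or> r = q" if "admissible_root t r"
  proof -
    have "fbar t r = 0" "r < 0" using that by (simp_all add: admissible_root_mixed[OF t])
    then show ?thesis using fac[of r] w by auto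
  qed
  have "fbar t (- t 1) < 0"
  proof -
    have "(- t 1 - p) * (- t 1 - q) > 0" "- t 1 - w < 0"
      using p'(2,5) w t by (simp_all add: mult_neg_neg)
    then have "2 * ((- t 1 - p) * (- t 1 - q)) * (- t 1 - w) < 0" by (intro mult_pos_neg) auto
    then show ?thesis unfolding fac by (simp only: mult.assoc)
  qed
  moreover have "fbar t (- (m / 3)) > 0"
  proof -
    have r: "fbar t (- (m / 3)) = 2 * (z + m / 3)\<^sup>2 * (m / 6 - z)" if "fbar t z = 0" for z
    proof -
      have "fbar t z = fbar t (- (m / 3)) + 2 * (z + m / 3)\<^sup>2 * (z - m / 6)"
        unfolding m_def by (rule fbar_critical_value)
      then have "fbar t (- (m / 3)) = - (2 * (z + m / 3)\<^sup>2 * (z - m / 6))"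
        unfolding that by (simp only: eq_neg_iff_add_eq_0)
      then show ?thesis by (simp only: mult_minus_right[symmetric] minus_diff_eq)
    qed
    have "p + m / 3 \<noteq> 0 \<or> q + m / 3 \<noteq> 0" using p(3) by (metis add_right_cancel)
    moreover have "p < m / 6" "q < m / 6" using p'(3,6) m by linarith+
    ultimately show ?thesis
    proof (elim disjE)
      assume "p + m / 3 \<noteq> 0"
      then show ?thesis unfolding r[OF p'(1)] using \<open>p < m / 6\<close> by (intro mult_pos_pos) auto
    next
      assume "q + m / 3 \<noteq> 0"
      then show ?thesis unfolding r[OF p'(4)] using \<open>q < m / 6\<close> by (intro mult_pos_pos) auto
    qed
  qed
  ultimately show "cond_two_solutions t"
    unfolding cond_two_solutions_def m_def[symmetric] using m by simp
qed

text \<open>The signs at \<open>- t 1\<close>, at the critical point and at 0 are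
negative, positive, negative.\<close>

lemma admissible_root_mixed_two_exist:
  assumes t: "t 1 > 0" "t 2 < 0" "t 3 < 0" and c: "cond_two_solutions t"
  obtains p q where "admissible_root t p" "admissible_root t q" "p \<noteq> q"
proof -
  define q where "q = - ((t 1 + t 2 + t 3) / 3)"
  have q: "fbar t (- t 1) < 0" "q < 0" "fbar t q > 0"
    using c by (simp_all add: cond_two_solutions_def q_def)
  have "- t 1 < q" using t by (simp add: q_def)
  have neg0: "fbar t 0 < 0" using t by (simp add: fbar_def mult_neg_neg mult.assoc)
  obtain a where a: "- t 1 \<le> a" "a \<le> q" "fbar t a = 0"
    using fbar_IVT[of "- t 1" q t] q \<open>- t 1 < q\<close> by (auto simp: mult_le_0_iff)
  obtain b where b: "q \<le> b" "b \<le> 0" "fbar t b = 0"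
    using fbar_IVT[of q 0 t] q neg0 by (auto simp: mult_le_0_iff)
  have "a \<noteq> q" "b \<noteq> q" "a \<noteq> - t 1" "b \<noteq> 0" using a b q neg0 by auto
  with a b q have "- t 1 < a" "a < q" "q < b" "b < 0" by linarith+
  then show thesis
    using that[of a b] a b q \<open>- t 1 < q\<close> by (simp add: admissible_root_mixed[OF t])
qed

section \<open>From metrics to roots\<close>

lemma ordered_diagonalisation_iff:
  assumes T: "bilinear T"
  shows "ordered_diagonalisation T V t \<longleftrightarrow>
    (\<exists>h. so3_frame h \<and> V = (\<lambda>i. h (axis i 1)) \<and> diagonal_form h t T \<and> t 1 \<ge> t 2 \<and> t 2 \<ge> t 3)"
    (is "?l \<longleftrightarrow> ?r")
proof
  assume l: ?l
  then have "milnor_basis (\<lambda>_. 2) V" by (simp add: ordered_diagonalisation_def)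
  then obtain h where h: "so3_frame h" "\<And>i. V i = h (axis i 1)"
    using milnor_basis_frame by blast
  then have V: "V = (\<lambda>i. h (axis i 1))" by (intro ext)
  with l h(1) show ?r
    unfolding ordered_diagonalisation_def V diagonal_in_frame_iff[OF h(1) T] by blast
next
  assume ?r
  then show ?l
    by (auto simp: ordered_diagonalisation_def so3_frame_axis diagonal_in_frame_iff[OF _ T])
qed

lemma solution_diagonal_iff:
  assumes h: "so3_frame h" and g: "diagonal_form h x g"
  shows "solution T g c \<longleftrightarrow>
    (\<forall>i. x i > 0) \<and> c > 0 \<and> diagonal_form h (\<lambda>i. ricci_eigenvalue x i / c) T"
proof -
  note hh = so3_frameD[OF h]
  have "(\<forall>X Y. ricci g X Y = c * T X Y) \<longleftrightarrow> diagonal_form h (\<lambda>i. ricci_eigenvalue x i / c) T"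
    if x: "\<And>i. x i > 0" and c: "c > 0"
  proof -
    have "(\<forall>X Y. ricci g X Y = c * T X Y) \<longleftrightarrow> (\<forall>u v. ricci g (h u) (h v) = c * T (h u) (h v))"
      by (metis hh(5))
    also have "\<dots> \<longleftrightarrow> (\<forall>u v. T (h u) (h v) = (\<Sum>i\<in>UNIV. ricci_eigenvalue x i * u $ i * v $ i) / c)"
    proof -
      have "ricci g (h u) (h v) = (\<Sum>i\<in>UNIV. ricci_eigenvalue x i * u $ i * v $ i)" for u v
        using ricci_diagonal[OF h g x] by (simp add: diagonal_form_def)
      moreover have "a = c * b \<longleftrightarrow> b = a / c" for a b using c by (auto simp: field_simps)
      ultimately show ?thesis by simp
    qed
    also have "\<dots> \<longleftrightarrow> diagonal_form h (\<lambda>i. ricci_eigenvalue x i / c) T"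
      by (simp add: diagonal_form_def sum_divide_distrib)
    finally show ?thesis .
  qed
  then show ?thesis
    using diagonal_form_metric[OF h g] by (auto simp: solution_def)
qed

lemma solution_diagonal:
  assumes "solution T g c"
  obtains h x where "so3_frame h" "diagonal_form h x g" "\<forall>i. x i > 0" "c > 0"
    "diagonal_form h (\<lambda>i. ricci_eigenvalue x i / c) T"
proof -
  have "bilinear g" "\<And>X Y. g X Y = g Y X"
    using assms by (auto simp: solution_def left_inv_metric_def)
  then obtain h x where h: "so3_frame h" "diagonal_form h x g"
    using diagonalising_frame by blast
  with assms show thesis using that solution_diagonal_iff[OF h] by blast
qed

text \<open>The metric is diagonal in some frame, and so is \<open>T\<close>, but this frame need not be \<open>h\<close>. The metric
entries are functions of the nonzero eigenvalues of \<open>T\<close>, so diagonality can be transferred to \<open>h\<close>.\<close>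

lemma solution_diagonal_in_eigenframe:
  assumes h: "so3_frame h" "diagonal_form h t T" and t: "\<And>i. t i \<noteq> 0" and s: "solution T g c"
  obtains y where "diagonal_form h y g"
proof -
  obtain k x where k: "so3_frame k" "diagonal_form k x g" "\<forall>i. x i > 0" "c > 0"
    "diagonal_form k (\<lambda>i. ricci_eigenvalue x i / c) T"
    by (rule solution_diagonal[OF s])
  define r where "r i = ricci_eigenvalue x i / c" for i
  have kr: "diagonal_form k r T" using k(5) by (simp add: r_def[abs_def])
  have "r j \<noteq> 0" for j
    using diagonal_form_common_eigenvalue[OF k(1) kr h, of j] t by metis
  moreover have "ricci_eigenvalue x i = c * r i" for i using k(4) by (simp add: r_def)
  ultimately obtain p where "admissible_root r p" "c * (r 1 * r 2 * r 3) = 8 * p\<^sup>2"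
    "\<forall>i. x i = (\<Sum>j\<in>UNIV. x j) / 2 * (r i / (p + r i))"
    by (rule ricci_eigenvalue_imp_root[of x c r, OF k(3)[rule_format] k(4)])
  then have "x i = x j" if "r i = r j" for i j using that by metis
  then show thesis
    using diagonal_form_transfer[OF h k(1) kr k(2)] that by blast
qed

lemma ricci_eigenvalue_scale:
  assumes "m \<noteq> 0"
  shows "ricci_eigenvalue (\<lambda>i. m * x i) = ricci_eigenvalue x"
proof
  fix i
  have "(\<Sum>j\<in>UNIV. m * x j) = m * (\<Sum>j\<in>UNIV. x j)" by (simp add: sum_distrib_left)
  moreover have "2 * (m * s) * (m * a) * (m * s - 2 * (m * a)) / (m * b * (m * d) * (m * e))
      = 2 * s * a * (s - 2 * a) / (b * d * e)" for s a b d e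
  proof -
    have "2 * (m * s) * (m * a) * (m * s - 2 * (m * a)) = (m * m * m) * (2 * s * a * (s - 2 * a))"
      "m * b * (m * d) * (m * e) = (m * m * m) * (b * d * e)"
      by (simp_all add: algebra_simps)
    then show ?thesis using assms by (simp only: mult_divide_mult_cancel_left_if) simp
  qed
  ultimately show "ricci_eigenvalue (\<lambda>i. m * x i) i = ricci_eigenvalue x i"
    by (simp only: ricci_eigenvalue_def)
qed

text \<open>Solutions up to scaling correspond to admissible roots; \<open>m\<close> is the
scaling.\<close>

lemma solution_iff_root:
  assumes h: "so3_frame h" "diagonal_form h t T" and t: "t 1 * t 2 * t 3 > 0"
  shows "solution T g c \<longleftrightarrow> (\<exists>p m. admissible_root t p \<and> m > 0 \<and>
    c = 8 * p\<^sup>2 / (t 1 * t 2 * t 3) \<and> diagonal_form h (\<lambda>i. m * (t i / (p + t i))) g)"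
proof
  have nz: "t i \<noteq> 0" for i using exhaust_3[of i] t by auto
  assume s: "solution T g c"
  then obtain y where y: "diagonal_form h y g"
    using solution_diagonal_in_eigenframe[OF h nz] by blast
  have pos: "\<And>i. y i > 0" "c > 0" and "diagonal_form h (\<lambda>i. ricci_eigenvalue y i / c) T"
    using s solution_diagonal_iff[OF h(1) y] by auto
  then have "ricci_eigenvalue y i = c * t i" for i
    using diagonal_form_unique[OF h(2)] by fastforce
  then obtain p where p: "admissible_root t p" "c * (t 1 * t 2 * t 3) = 8 * p\<^sup>2"
    "\<forall>i. y i = (\<Sum>j\<in>UNIV. y j) / 2 * (t i / (p + t i))"
    by (rule ricci_eigenvalue_imp_root[of y c t, OF pos nz])
  have "(\<Sum>j\<in>UNIV. y j) > 0" using pos by (intro sum_pos) auto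
  moreover have "y = (\<lambda>i. (\<Sum>j\<in>UNIV. y j) / 2 * (t i / (p + t i)))"
    by (rule ext) (rule p(3)[rule_format])
  then have "diagonal_form h (\<lambda>i. (\<Sum>j\<in>UNIV. y j) / 2 * (t i / (p + t i))) g"
    using y by metis
  moreover have "c = 8 * p\<^sup>2 / (t 1 * t 2 * t 3)"
    using p(2) t by (metis less_irrefl nonzero_mult_div_cancel_right)
  ultimately show "\<exists>p m. admissible_root t p \<and> m > 0 \<and>
    c = 8 * p\<^sup>2 / (t 1 * t 2 * t 3) \<and> diagonal_form h (\<lambda>i. m * (t i / (p + t i))) g"
    using p(1) half_gt_zero by blast
next
  assume "\<exists>p m. admissible_root t p \<and> m > 0 \<and>
    c = 8 * p\<^sup>2 / (t 1 * t 2 * t 3) \<and> diagonal_form h (\<lambda>i. m * (t i / (p + t i))) g"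
  then obtain p m where p: "admissible_root t p" "m > 0" "c = 8 * p\<^sup>2 / (t 1 * t 2 * t 3)"
    and g: "diagonal_form h (\<lambda>i. m * (t i / (p + t i))) g" by blast
  have c: "c > 0" using p t by (simp add: admissible_root_def)
  have "ricci_eigenvalue (\<lambda>i. m * (t i / (p + t i))) i = c * t i" for i
    using ricci_eigenvalue_scale[of m "\<lambda>i. t i / (p + t i)"] p(2) root_imp_ricci_eigenvalue[OF p(1) t]
    by (simp add: p(3))
  then have "(\<lambda>i. ricci_eigenvalue (\<lambda>i. m * (t i / (p + t i))) i / c) = t"
    using c by auto
  moreover have "m * (t i / (p + t i)) > 0" for i
    using p by (intro mult_pos_pos) (auto simp: admissible_root_def)
  ultimately show "solution T g c"
    using solution_diagonal_iff[OF h(1) g] c h(2) by simp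
qed

lemma diagonal_form_same_up_to_scaling:
  assumes h: "so3_frame h" and g: "diagonal_form h (\<lambda>i. m * x i) g" "m > 0"
    and g': "diagonal_form h (\<lambda>i. n * x i) g'" "n > 0"
  shows "same_up_to_scaling (g, c) (g', c)"
proof -
  have "g' X Y = (n / m) * g X Y" for X Y
    using g(2) by (simp add: diagonal_form_eq[OF h g(1)] diagonal_form_eq[OF h g'(1)]
        sum_distrib_left mult.assoc)
  moreover have "n / m > 0" using g g' by simp
  ultimately show ?thesis unfolding same_up_to_scaling_def by auto
qed

section \<open>Counting solutions\<close>

lemma unique_solution_of_root:
  assumes h: "so3_frame h" "diagonal_form h t T" and t: "t 1 * t 2 * t 3 > 0"
    and p: "\<exists>!p. admissible_root t p"
  shows "unique_solution T"
proof -
  obtain p where p: "admissible_root t p" "\<And>q. admissible_root t q \<Longrightarrow> q = p"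
    using p by blast
  obtain g where g: "diagonal_form h (\<lambda>i. 1 * (t i / (p + t i))) g"
    using diagonal_form_exists[OF h(1)] by blast
  define c where "c = 8 * p\<^sup>2 / (t 1 * t 2 * t 3)"
  have "solution T g c"
    unfolding solution_iff_root[OF h t] using p(1) g zero_less_one c_def by blast
  moreover have "same_up_to_scaling (g, c) (g', c')" if s: "solution T g' c'" for g' c'
  proof -
    from s obtain m where m: "m > 0" "c' = c" "diagonal_form h (\<lambda>i. m * (t i / (p + t i))) g'"
      unfolding solution_iff_root[OF h t] c_def using p(2) by blast
    then show ?thesis using diagonal_form_same_up_to_scaling[OF h(1) g zero_less_one m(3,1)] by simp
  qed
  ultimately show ?thesis unfolding unique_solution_def by blast
qed

text \<open>The constants are proportional to \<open>p\<^sup>2\<close> and \<open>q\<^sup>2\<close>, whence the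
assumption on the squares.\<close>

lemma two_solutions_of_roots:
  assumes h: "so3_frame h" "diagonal_form h t T" and t: "t 1 * t 2 * t 3 > 0"
    and pq: "admissible_root t p" "admissible_root t q" "p\<^sup>2 \<noteq> q\<^sup>2"
    and only: "\<And>r. admissible_root t r \<Longrightarrow> r = p \<or> r = q"
  shows "\<exists>g\<^sub>1 c\<^sub>1 g\<^sub>2 c\<^sub>2. solution T g\<^sub>1 c\<^sub>1 \<and> solution T g\<^sub>2 c\<^sub>2 \<and> c\<^sub>1 \<noteq> c\<^sub>2 \<and>
    (\<forall>g c. solution T g c \<longrightarrow>
      same_up_to_scaling (g\<^sub>1, c\<^sub>1) (g, c) \<or> same_up_to_scaling (g\<^sub>2, c\<^sub>2) (g, c))"
proof -
  define C where "C r = 8 * r\<^sup>2 / (t 1 * t 2 * t 3)" for r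
  have "\<exists>g. diagonal_form h (\<lambda>i. 1 * (t i / (r + t i))) g" for r
    using diagonal_form_exists[OF h(1)] by blast
  then obtain G where G: "\<And>r. diagonal_form h (\<lambda>i. 1 * (t i / (r + t i))) (G r)" by metis
  have "solution T (G r) (C r)" if "admissible_root t r" for r
    unfolding solution_iff_root[OF h t] C_def using that G zero_less_one by blast
  moreover have "C p \<noteq> C q" using pq(3) less_imp_neq[OF t] unfolding C_def by simp
  moreover have "same_up_to_scaling (G p, C p) (g, c) \<or> same_up_to_scaling (G q, C q) (g, c)"
    if s: "solution T g c" for g c
  proof -
    from s obtain r m where m: "admissible_root t r" "m > 0" "c = C r"
      "diagonal_form h (\<lambda>i. m * (t i / (r + t i))) g"
      unfolding solution_iff_root[OF h t] C_def by blast
    then have "same_up_to_scaling (G r, C r) (g, c)"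
      using diagonal_form_same_up_to_scaling[OF h(1) G zero_less_one m(4,2)] by simp
    then show ?thesis using only[OF m(1)] by blast
  qed
  ultimately show ?thesis using pq(1,2) by blast
qed

lemma unique_solution_positive:
  assumes h: "so3_frame h" "diagonal_form h t T" and t: "\<And>i. t i > 0"
  shows "unique_solution T"
  using unique_solution_of_root[OF h] admissible_root_positive_ex1[OF t] t by simp

lemma unique_solution_mixed:
  assumes h: "so3_frame h" "diagonal_form h t T" and t: "t 1 > 0" "t 2 < 0" "t 3 < 0"
    and c: "cond_iii t" "\<not> cond_two_solutions t"
  shows "unique_solution T"
proof (rule unique_solution_of_root[OF h])
  show "t 1 * t 2 * t 3 > 0" using t by (simp add: mult_neg_neg mult.assoc)
  have "\<exists>p. admissible_root t p"
    using c(1) admissible_root_mixed_exists_iff[of t] t by (simp add: cond_iii_def)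
  then show "\<exists>!p. admissible_root t p"
    using admissible_root_mixed_two(1)[OF t] c(2) by blast
qed

lemma two_solutions_mixed:
  assumes h: "so3_frame h" "diagonal_form h t T" and t: "t 1 > 0" "t 2 < 0" "t 3 < 0"
    and c: "cond_two_solutions t"
  shows "\<exists>g\<^sub>1 c\<^sub>1 g\<^sub>2 c\<^sub>2. solution T g\<^sub>1 c\<^sub>1 \<and> solution T g\<^sub>2 c\<^sub>2 \<and> c\<^sub>1 \<noteq> c\<^sub>2 \<and>
    (\<forall>g c. solution T g c \<longrightarrow>
      same_up_to_scaling (g\<^sub>1, c\<^sub>1) (g, c) \<or> same_up_to_scaling (g\<^sub>2, c\<^sub>2) (g, c))"
proof -
  obtain p q where pq: "admissible_root t p" "admissible_root t q" "p \<noteq> q"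
    by (rule admissible_root_mixed_two_exist[OF t c])
  have "p < 0" "q < 0" using pq admissible_root_mixed[OF t] by blast+
  then have "p\<^sup>2 \<noteq> q\<^sup>2" using pq(3) by (auto simp: power2_eq_iff)
  moreover have "t 1 * t 2 * t 3 > 0" using t by (simp add: mult_neg_neg mult.assoc)
  ultimately show ?thesis
    using two_solutions_of_roots[OF h _ pq(1,2)] admissible_root_mixed_two(2)[OF t pq] by blast
qed

text \<open>Here the metric need not be diagonal in \<open>h\<close>, but in a frame where it is, the eigenvalues of \<open>T\<close>
are still among those in \<open>h\<close>, and one of them is \<open>8 / c\<close>.\<close>

lemma rank_one_constant:
  assumes h: "so3_frame h" "diagonal_form h t T" and t: "t 1 > 0" "t 2 = 0" "t 3 = 0"
    and s: "solution T g c"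
  shows "c = 8 / t 1"
proof -
  obtain k x where k: "so3_frame k" "diagonal_form k x g" "\<forall>i. x i > 0" "c > 0"
    "diagonal_form k (\<lambda>i. ricci_eigenvalue x i / c) T"
    by (rule solution_diagonal[OF s])
  obtain i where "ricci_eigenvalue x i / c = t 2"
    using diagonal_form_common_eigenvalue[OF h k(1,5)] by blast
  then have "ricci_eigenvalue x i = 0" using t k(4) by simp
  then obtain j where j: "ricci_eigenvalue x j = 8" "\<forall>k. k \<noteq> j \<longrightarrow> ricci_eigenvalue x k = 0"
    by (rule ricci_eigenvalue_zero[of x i, OF k(3)[rule_format]])
  obtain l where "t l = ricci_eigenvalue x j / c"
    using diagonal_form_common_eigenvalue[OF k(1,5) h] by blast
  then have "t l = 8 / c" using j(1) by simp
  moreover have "t l = t 1 \<or> t l = 0" using exhaust_3[of l] t by auto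
  ultimately have "t 1 = 8 / c" using k(4) by auto
  then show ?thesis using k(4) t by (simp add: field_simps)
qed

text \<open>The entries \<open>1 + a, 1, a\<close> satisfy \<open>x\<^sub>1 = x\<^sub>2 + x\<^sub>3\<close>, that is \<open>e\<^sub>1 = 0\<close>.\<close>

lemma rank_one_solution:
  assumes h: "so3_frame h" "diagonal_form h t T" and t: "t 1 > 0" "t 2 = 0" "t 3 = 0"
    and a: "a > 0" and g: "diagonal_form h (\<lambda>i. if i = 1 then 1 + a else if i = 2 then 1 else a) g"
  shows "solution T g (8 / t 1)"
proof -
  define x where "x i = (if i = 1 then 1 + a else if i = 2 then 1 else a)" for i :: 3
  have pos: "x i > 0" for i using a by (simp add: x_def)
  have e: "(\<Sum>j\<in>UNIV. x j) - 2 * x 1 = 0" by (simp add: sum_3 x_def)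
  have "ricci_eigenvalue x 1 = 8" by (simp add: ricci_eigenvalue_def e)
  moreover have "ricci_eigenvalue x 2 = 0" "ricci_eigenvalue x 3 = 0"
    using ricci_eigenvalue_product(2,3)[of x, OF pos] pos[of 1] pos[of 2] pos[of 3] by (simp_all add: e)
  ultimately have "ricci_eigenvalue x i / (8 / t 1) = t i" for i
    using exhaust_3[of i] t by auto
  then have "(\<lambda>i. ricci_eigenvalue x i / (8 / t 1)) = t" by (rule ext)
  then show ?thesis
    using solution_diagonal_iff[OF h(1) g[folded x_def]] pos h(2) t(1) by simp
qed

text \<open>The entries \<open>1 + a, 1, a\<close> with different \<open>a\<close> are not proportional, because the second entry fixes
the scaling.\<close>

lemma rank_one_infinite:
  assumes h: "so3_frame h" "diagonal_form h t T" and t: "t 1 > 0" "t 2 = 0" "t 3 = 0"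
  shows "infinite (solution_classes T)"
proof
  assume fin: "finite (solution_classes T)"
  define x where "x a i = (if i = 1 then 1 + a else if i = 2 then 1 else a)" for a :: real and i :: 3
  define G where "G a X Y = (\<Sum>i\<in>UNIV. x a i * inv h X $ i * inv h Y $ i)" for a X Y
  define R where "R = {(s, s'). (\<forall>u\<in>{s, s'}. solution T (fst u) (snd u)) \<and> same_up_to_scaling s s'}"
  define c where "c = 8 / t 1"
  have G: "diagonal_form h (x a) (G a)" for a
    unfolding G_def[abs_def] by (rule diagonal_form_exists[OF h(1)])
  have sol: "solution T (G a) c" if "a > 0" for a
    using rank_one_solution[OF h t that] G[of a] by (simp add: x_def[abs_def] c_def)
  have "R `` {(G a, c)} \<in> solution_classes T" if "a > 0" for a
    using sol[OF that] unfolding solution_classes_def R_def[symmetric] by (auto intro: quotientI)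
  then have "(\<lambda>a. R `` {(G a, c)}) ` {0<..} \<subseteq> solution_classes T" by auto
  moreover have "inj_on (\<lambda>a. R `` {(G a, c)}) {0<..}"
  proof (rule inj_onI)
    fix a b :: real
    assume ab: "a \<in> {0<..}" "b \<in> {0<..}" and eq: "R `` {(G a, c)} = R `` {(G b, c)}"
    have "same_up_to_scaling (G b, c) (G b, c)"
      by (auto simp: same_up_to_scaling_def intro: exI[of _ 1])
    then have "(G b, c) \<in> R `` {(G b, c)}" using sol ab by (simp add: R_def)
    then have "same_up_to_scaling (G a, c) (G b, c)" using eq by (auto simp: R_def)
    then obtain m where m: "\<And>X Y. G b X Y = m * G a X Y" by (auto simp: same_up_to_scaling_def)
    have "x b i = m * x a i" for i
      using m[of "h (axis i 1)" "h (axis i 1)"] by (simp add: diagonal_form_axis[OF G])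
    from this[of 2] this[of 3] show "a = b" by (simp add: x_def)
  qed
  ultimately have "finite ({0<..} :: real set)"
    using fin by (meson finite_imageD finite_subset)
  then show False using infinite_Ioi by blast
qed

text \<open>If an eigenvalue vanishes, two do and the third is positive, so it comes first in the order. If none
vanishes, \<open>c t\<^sub>1 t\<^sub>2 t\<^sub>3 = 8 p\<^sup>2 > 0\<close> leaves the sign patterns \<open>+, +, +\<close> and \<open>+, -, -\<close>.\<close>

lemma ricci_eigenvalues_satisfy_condition:
  assumes x: "\<And>i. x i > 0" and c: "c > 0" and r: "\<And>i. ricci_eigenvalue x i = c * t i"
    and t: "t 1 \<ge> t 2" "t 2 \<ge> t 3"
  shows "cond_i t \<or> cond_ii t \<or> cond_iii t"
proof (cases "\<exists>i. t i = 0")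
  case True
  then obtain j where j: "ricci_eigenvalue x j = 8" "\<forall>k. k \<noteq> j \<longrightarrow> ricci_eigenvalue x k = 0"
  proof -
    from True obtain i where "ricci_eigenvalue x i = 0" using r by auto
    then show thesis by (rule ricci_eigenvalue_zero[of x i, OF x]) (rule that)
  qed
  then have "c * t j = 8" and z: "\<And>k. k \<noteq> j \<Longrightarrow> t k = 0" using r c by auto
  then have pos: "t j > 0" using c by (metis zero_less_mult_pos zero_less_numeral)
  then have "j = 1" using exhaust_3[of j] z[of 1] z[of 2] t by auto
  then show ?thesis using pos z by (simp add: cond_ii_def)
next
  case False
  then have nz: "\<And>i. t i \<noteq> 0" by blast
  obtain p where p: "admissible_root t p" "c * (t 1 * t 2 * t 3) = 8 * p\<^sup>2"
    "\<forall>i. x i = (\<Sum>j\<in>UNIV. x j) / 2 * (t i / (p + t i))"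
    by (rule ricci_eigenvalue_imp_root[of x c t, OF x c nz r])
  have "c * (t 1 * t 2 * t 3) > 0" using p by (simp add: admissible_root_def)
  then have e3: "t 1 * t 2 * t 3 > 0" using c by (rule zero_less_mult_pos)
  show ?thesis
  proof (cases "t 3 > 0")
    case True
    then show ?thesis using t by (simp add: cond_i_def)
  next
    case False
    then have "t 3 < 0" using nz[of 3] by simp
    with e3 have "t 1 * t 2 < 0" by (metis mult_less_0_iff not_less_iff_gr_or_eq zero_less_mult_iff)
    with t have s: "t 1 > 0" "t 2 < 0" by (auto simp: mult_less_0_iff)
    then show ?thesis using admissible_root_mixed_exists_iff[OF s(1) t(2) s(2)] p(1) by blast
  qed
qed

theorem theorem4p1:
  fixes T :: "so3 \<Rightarrow> so3 \<Rightarrow> real"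
  assumes "bilinear T"
  shows "((\<exists>g c. solution T g c) \<longleftrightarrow>
           (\<exists>V t. ordered_diagonalisation T V t \<and> (cond_i t \<or> cond_ii t \<or> cond_iii t))) \<and>
         (\<forall>V t. ordered_diagonalisation T V t \<longrightarrow>
           (cond_i t \<longrightarrow> unique_solution T) \<and>
           (cond_ii t \<longrightarrow>
              infinite (solution_classes T) \<and>
              (\<exists>c\<^sub>0. \<forall>g c. solution T g c \<longrightarrow> c = c\<^sub>0)) \<and>
           (cond_iii t \<and> \<not> cond_two_solutions t \<longrightarrow> unique_solution T) \<and>
           (cond_iii t \<and> cond_two_solutions t \<longrightarrow>
              (\<exists>g\<^sub>1 c\<^sub>1 g\<^sub>2 c\<^sub>2. solution T g\<^sub>1 c\<^sub>1 \<and> solution T g\<^sub>2 c\<^sub>2 \<and> c\<^sub>1 \<noteq> c\<^sub>2 \<and>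
                 (\<forall>g c. solution T g c \<longrightarrow>
                    same_up_to_scaling (g\<^sub>1, c\<^sub>1) (g, c) \<or> same_up_to_scaling (g\<^sub>2, c\<^sub>2) (g, c)))))"
    (is "(?ex \<longleftrightarrow> ?diag) \<and> ?count")
proof -
  note od = ordered_diagonalisation_iff[OF assms]
  have frame: "\<exists>h. so3_frame h \<and> diagonal_form h t T" if "ordered_diagonalisation T V t" for V t
    using that unfolding od by auto
  have i: "unique_solution T" if V: "ordered_diagonalisation T V t" and C: "cond_i t" for V t
  proof -
    obtain h where h: "so3_frame h" "diagonal_form h t T" using frame[OF V] by blast
    have t: "t i > 0" for i using C exhaust_3[of i] by (auto simp: cond_i_def)
    show ?thesis by (rule unique_solution_positive[OF h t])
  qed
  have ii: "infinite (solution_classes T)" "\<forall>g c. solution T g c \<longrightarrow> c = 8 / t 1"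
    "\<exists>g c. solution T g c"
    if V: "ordered_diagonalisation T V t" and C: "cond_ii t" for V t
  proof -
    obtain h where h: "so3_frame h" "diagonal_form h t T" using frame[OF V] by blast
    have t: "t 1 > 0" "t 2 = 0" "t 3 = 0" using C by (auto simp: cond_ii_def)
    show "infinite (solution_classes T)" by (rule rank_one_infinite[OF h t])
    show "\<forall>g c. solution T g c \<longrightarrow> c = 8 / t 1" using rank_one_constant[OF h t] by blast
    show "\<exists>g c. solution T g c"
      using rank_one_solution[OF h t zero_less_one diagonal_form_exists[OF h(1)]] by blast
  qed
  have iii: "t 1 > 0" "t 2 < 0" "t 3 < 0" if "cond_iii t" for t
    using that by (auto simp: cond_iii_def)
  have iii_one: "unique_solution T"
    if V: "ordered_diagonalisation T V t" and C: "cond_iii t" and one: "\<not> cond_two_solutions t" for V t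
  proof -
    obtain h where h: "so3_frame h" "diagonal_form h t T" using frame[OF V] by blast
    show ?thesis by (rule unique_solution_mixed[OF h iii[OF C] C one])
  qed
  have iii_two: "\<exists>g\<^sub>1 c\<^sub>1 g\<^sub>2 c\<^sub>2. solution T g\<^sub>1 c\<^sub>1 \<and> solution T g\<^sub>2 c\<^sub>2 \<and> c\<^sub>1 \<noteq> c\<^sub>2 \<and>
       (\<forall>g c. solution T g c \<longrightarrow>
          same_up_to_scaling (g\<^sub>1, c\<^sub>1) (g, c) \<or> same_up_to_scaling (g\<^sub>2, c\<^sub>2) (g, c))"
    if V: "ordered_diagonalisation T V t" and C: "cond_iii t" and two: "cond_two_solutions t" for V t
  proof -
    obtain h where h: "so3_frame h" "diagonal_form h t T" using frame[OF V] by blast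
    show ?thesis by (rule two_solutions_mixed[OF h iii[OF C] two])
  qed
  have "?ex \<Longrightarrow> ?diag"
  proof -
    assume ?ex
    then obtain g c where s: "solution T g c" by blast
    obtain k x where k: "so3_frame k" "diagonal_form k x g" "\<forall>i. x i > 0" "c > 0"
      "diagonal_form k (\<lambda>i. ricci_eigenvalue x i / c) T"
      by (rule solution_diagonal[OF s])
    obtain h y t where h: "so3_frame h" "diagonal_form h y g" "diagonal_form h t T"
      "t 1 \<ge> t 2" "t 2 \<ge> t 3"
      by (rule diagonal_form_sort[OF k(1,2,5)])
    have y: "\<And>i. y i > 0" "c > 0" and "diagonal_form h (\<lambda>i. ricci_eigenvalue y i / c) T"
      using s solution_diagonal_iff[OF h(1,2)] by auto
    then have "ricci_eigenvalue y i = c * t i" for i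
      using diagonal_form_unique[OF h(3)] by fastforce
    then have "cond_i t \<or> cond_ii t \<or> cond_iii t"
      by (rule ricci_eigenvalues_satisfy_condition[OF y _ h(4,5)])
    moreover have "ordered_diagonalisation T (\<lambda>i. h (axis i 1)) t"
      unfolding od using h by blast
    ultimately show ?diag by blast
  qed
  moreover have "?diag \<Longrightarrow> ?ex"
    using i ii(3) iii_one iii_two unfolding unique_solution_def by meson
  moreover have ?count
    using i ii(1,2) iii_one iii_two by blast
  ultimately show ?thesis by blast
qed

end
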